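(* For every $n\ge1$, the map $$\Gamma=\Phi^{-1}\circ\mathcal{S}\circ\mathrm{DE}\circ\Psi$$ is a bijection from the set of NEW-tableaux of size $n$ to the set of Le-tableaux of size $n$, and it preserves shape: for each NEW-tableau $\mathcal{N}$, the underlying Ferrers diagram (including empty rows) of $\Gamma(\mathcal{N})$ is that of $\mathcal{N}$.
   Context: A Ferrers diagram is a left-aligned array of cells whose row lengths weakly decrease from top to bottom; here some bottommost rows may be empty. NEW-tableau: a 0/1-filling of a Ferrers diagram, possibly with some empty bottom rows, such that (1) every column has a 1; (2) no four cells forming the corners of a rectangle have 0s in two diagonally opposite corners and 1s in the other two. Le-tableau: a 0/1-filling of a Ferrers diagram, some of whose bottommost rows may be empty, such that (1) every column has a 1 in some cell; (2) if a cell has a 1 above it in the same column and a 1 to its left in the same row then it contains a 1. The size of either kind of tableau is (number of rows) + (number of columns), empty rows included. Labels: for size $n$, number the unit steps of the southeast border, from the northeast corner to the southwest corner, by $1,\dots,n$; the vertical step at the right end of a row is that row's label (an empty row also has a vertical step), and the horizontal step at the bottom of a column is that column's label. The map $\Psi$ from NEW-tableaux of size $n$ to permutations of $\{1,\dots,n\}$: repeat the following until all labels have been read: (i) write down the labels of all unread columns containing no 1s, from right to left, and delete the entries of these columns; (ii) write down the labels of all unread rows containing no 0s (empty rows included), from bottom to top, and delete the entries of these rows. The resulting word is $\Psi(\mathcal{N})$. $\mathrm{DE}:\mathcal{S}_n\to\mathcal{S}_n$: for $\pi=a_1\dots a_n$ put $a_0=0$ and $\mathrm{DE}(\pi)=b_1\dots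 b_n$, where for each $1\le i\le n$: if $a_i>a_j$ for some $j>i$ then $b_{a_{i+1}}=a_i$; otherwise let $a_k$ ($0\le k<i$) be the rightmost letter smaller than $a_i$ and set $b_{a_{k+1}}=a_i$. This is a bijection. $\mathcal{S}:\mathcal{S}_n\to\mathcal{S}_n$ is the cyclic down-shift: subtract 1 from each letter of the permutation and change the resulting $0$ to $n$. $\Phi$ is the known (Postnikov; Steingr\'imsson–Williams) bijection from Le-tableaux of size $n$ to permutations of $\{1,\dots,n\}$: copy the label of each row also to its left end and the label of each column also to its top end. From label $\ell$ on the left or top border, enter the tableau (heading right from a row label, down from a column label) and move straight through 0s; at each 1, turn to head right if heading down, and to head down if heading right. The label on the southeast border at which the path exits is the letter in place $\ell$ of $\Phi(\mathcal{L})$ (for an empty row $\ell$ the path exits immediately at $\ell$). *)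

theory Defs
  imports Main "HOL-Library.While_Combinator"
begin

text \<open>
  A 0/1-filling of a Ferrers diagram is the list of its rows from top to bottom, each read from left
  to right; \<open>True\<close> stands for 1. Rows and columns are indexed from 0. Since the rows are
  left-aligned, the top row is a longest one and its length is the number of columns.
\<close>

type_synonym tableau = "bool list list"

definition shape :: "tableau \<Rightarrow> nat list" where
  "shape T = map length T"

definition ferrers :: "tableau \<Rightarrow> bool" where
  "ferrers T \<longleftrightarrow> sorted_wrt (\<ge>) (shape T)"

definition num_rows :: "tableau \<Rightarrow> nat" where
  "num_rows T = length T"

definition num_cols :: "tableau \<Rightarrow> nat" where
  "num_cols T = (case T of [] \<Rightarrow> 0 | r # _ \<Rightarrow> length r)"

definition tableau_size :: "tableau \<Rightarrow> nat" where
  "tableau_size T = num_rows T + num_cols T"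

definition in_diagram :: "tableau \<Rightarrow> nat \<Rightarrow> nat \<Rightarrow> bool" where
  "in_diagram T i j \<longleftrightarrow> i < length T \<and> j < length (T ! i)"

definition has_one :: "tableau \<Rightarrow> nat \<Rightarrow> nat \<Rightarrow> bool" where
  "has_one T i j \<longleftrightarrow> in_diagram T i j \<and> T ! i ! j"

definition has_zero :: "tableau \<Rightarrow> nat \<Rightarrow> nat \<Rightarrow> bool" where
  "has_zero T i j \<longleftrightarrow> in_diagram T i j \<and> \<not> T ! i ! j"

definition every_col_has_one :: "tableau \<Rightarrow> bool" where
  "every_col_has_one T \<longleftrightarrow> (\<forall>j<num_cols T. \<exists>i<num_rows T. has_one T i j)"

definition NEW_tableau :: "tableau \<Rightarrow> bool" where
  "NEW_tableau T \<longleftrightarrow> ferrers T \<and> every_col_has_one T \<and>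
     (\<forall>i i' j j'. i < i' \<and> j < j' \<longrightarrow>
        \<not> (has_zero T i j \<and> has_zero T i' j' \<and> has_one T i j' \<and> has_one T i' j) \<and>
        \<not> (has_one T i j \<and> has_one T i' j' \<and> has_zero T i j' \<and> has_zero T i' j))"

definition Le_tableau :: "tableau \<Rightarrow> bool" where
  "Le_tableau T \<longleftrightarrow> ferrers T \<and> every_col_has_one T \<and>
     (\<forall>i i' j j'. in_diagram T i j \<and> i' < i \<and> j' < j \<and> has_one T i' j \<and> has_one T i j'
        \<longrightarrow> has_one T i j)"

definition NEW_tableaux :: "nat \<Rightarrow> tableau set" where
  "NEW_tableaux n = {T. NEW_tableau T \<and> tableau_size T = n}"

definition Le_tableaux :: "nat \<Rightarrow> tableau set" where
  "Le_tableaux n = {T. Le_tableau T \<and> tableau_size T = n}"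


text \<open>
  The steps of the southeast border, listed from the northeast to the southwest corner:
  \<open>Vert i\<close> is the right end of row \<open>i\<close>, \<open>Horiz j\<close> the bottom of column \<open>j\<close>.
\<close>

datatype border_step = Vert nat | Horiz nat

definition row_length :: "tableau \<Rightarrow> nat \<Rightarrow> nat" where
  "row_length T i = (if i < length T then length (T ! i) else 0)"

definition border :: "tableau \<Rightarrow> border_step list" where
  "border T = concat (map (\<lambda>i. Vert i # map Horiz (rev [row_length T (Suc i)..<row_length T i]))
                          [0..<num_rows T])"

definition label :: "tableau \<Rightarrow> border_step \<Rightarrow> nat" where
  "label T s = Suc (length (takeWhile (\<lambda>s'. s' \<noteq> s) (border T)))"


text \<open>
  A permutation of \<open>{1..n}\<close> is represented as a word, i.e. the list of its \<open>n\<close> letters.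

  In \<open>Psi\<close> the state \<open>(C, R, w)\<close> consists of the unread columns from left to right, the unread rows
  from top to bottom, and the word written so far. An entry survives iff its row and its column are
  both unread. The loop ends on NEW-tableaux; its value on other fillings is irrelevant.
\<close>

definition Psi_round ::
  "tableau \<Rightarrow> nat list \<times> nat list \<times> nat list \<Rightarrow> nat list \<times> nat list \<times> nat list" where
  "Psi_round T = (\<lambda>(C, R, w).
     let no_ones = (\<lambda>j. \<forall>i\<in>set R. \<not> has_one T i j);
         C' = filter (\<lambda>j. \<not> no_ones j) C;
         no_zeros = (\<lambda>i. \<forall>j\<in>set C'. \<not> has_zero T i j);
         R' = filter (\<lambda>i. \<not> no_zeros i) R
     in (C', R', w @ map (\<lambda>j. label T (Horiz j)) (rev (filter no_ones C))
                   @ map (\<lambda>i. label T (Vert i)) (rev (filter no_zeros R))))"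

definition Psi :: "tableau \<Rightarrow> nat list" where
  "Psi T = (case while (\<lambda>(C, R, w). C \<noteq> [] \<or> R \<noteq> []) (Psi_round T)
                       ([0..<num_cols T], [0..<num_rows T], [])
            of (C, R, w) \<Rightarrow> w)"


text \<open>\<open>letter \<pi> i\<close> is \<open>a\<^sub>i\<close>, with the convention \<open>a\<^sub>0 = 0\<close>.\<close>

definition letter :: "nat list \<Rightarrow> nat \<Rightarrow> nat" where
  "letter \<pi> i = (0 # \<pi>) ! i"

text \<open>\<open>DE_place \<pi> i\<close> is the index \<open>m\<close> for which \<open>b\<^sub>m\<close> is set to \<open>a\<^sub>i\<close>.\<close>

definition DE_place :: "nat list \<Rightarrow> nat \<Rightarrow> nat" where
  "DE_place \<pi> i =
     (if \<exists>j\<in>{i<..length \<pi>}. letter \<pi> i > letter \<pi> j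
      then letter \<pi> (Suc i)
      else letter \<pi> (Suc (Max {k \<in> {..<i}. letter \<pi> k < letter \<pi> i})))"

definition DE :: "nat list \<Rightarrow> nat list" where
  "DE \<pi> = map (\<lambda>m. letter \<pi> (THE i. i \<in> {1..length \<pi>} \<and> DE_place \<pi> i = m)) [1..<Suc (length \<pi>)]"

definition down_shift :: "nat list \<Rightarrow> nat list" where
  "down_shift \<pi> = map (\<lambda>a. if a - 1 = 0 then length \<pi> else a - 1) \<pi>"


datatype heading = Rightwards | Downwards

text \<open>
  \<open>exit_step T d i j\<close> is the border step through which the path leaves that is about to enter
  position \<open>(i, j)\<close> with heading \<open>d\<close>.
\<close>

function exit_step :: "tableau \<Rightarrow> heading \<Rightarrow> nat \<Rightarrow> nat \<Rightarrow> border_step" where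
  "exit_step T Rightwards i j =
     (if \<not> in_diagram T i j then Vert i
      else if has_one T i j then exit_step T Downwards (Suc i) j
      else exit_step T Rightwards i (Suc j))"
| "exit_step T Downwards i j =
     (if \<not> in_diagram T i j then Horiz j
      else if has_one T i j then exit_step T Rightwards i (Suc j)
      else exit_step T Downwards (Suc i) j)"
  by pat_completeness auto

lemma in_diagram_bound: "in_diagram T i j \<Longrightarrow> i + j < length T + sum_list (map length T)"
  unfolding in_diagram_def
  by (metis add_less_mono elem_le_sum_list length_map nth_map order_less_le_trans)

termination
  by (relation "measure (\<lambda>(T, d, i, j). length T + sum_list (map length T) - (i + j))")
     (auto dest: in_diagram_bound)

fun entry_exit :: "tableau \<Rightarrow> border_step \<Rightarrow> border_step" where
  "entry_exit T (Vert i) = exit_step T Rightwards i 0"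
| "entry_exit T (Horiz j) = exit_step T Downwards 0 j"

definition Phi :: "tableau \<Rightarrow> nat list" where
  "Phi T = map (\<lambda>s. label T (entry_exit T s)) (border T)"


definition Gamma :: "nat \<Rightarrow> tableau \<Rightarrow> tableau" where
  "Gamma n = inv_into (Le_tableaux n) Phi \<circ> down_shift \<circ> DE \<circ> Psi"

end

theory Submission
  imports Defs "HOL-Combinatorics.Permutations"
begin

text \<open>
  Both \<open>Psi\<close> and \<open>Phi\<close> turn out to be bijections onto the words of the permutations of \<open>{1..n}\<close>,
  and \<open>DE\<close> and \<open>down_shift\<close> permute these words; hence \<open>Gamma\<close> is a bijection. It preserves the
  shape because the shape can be seen in the permutation at either end: the labels of the rows
  determine the Ferrers diagram, and \<open>down_shift \<circ> DE\<close> carries one description of these labels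
  to the other.

  Shape. In the word \<open>Psi N\<close> the columns of a batch are read with increasing labels and the rows of
  a batch with decreasing labels; a row that becomes full has just lost a column with a 0 in it, and
  a column that becomes empty has just lost a row with a 1 in it, so the word falls when it passes
  to a row and rises when it passes to a column. The row labels of \<open>N\<close> are therefore the first
  letter of \<open>Psi N\<close> and its descent bottoms (\<open>Psi_spec\<close>). \<open>DE\<close> puts \<open>a\<^sub>i\<close> in place \<open>a\<^bsub>i+1\<^esub>\<close>, or else
  in a place that is at least \<open>a\<^sub>i\<close> unless \<open>a\<^sub>i = 1\<close>; after the shift the descent bottoms and the
  first letter become exactly the weak excedances (\<open>weak_excedances_bottoms\<close>). And the weak
  excedances of \<open>Phi L\<close> are the row labels of \<open>L\<close> (\<open>row_labels_weak_excedances\<close>).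

  \<open>Phi\<close> is bijective. Tableaux are built along the border. The next border step appends an empty
  row or prepends a column, given by the nonempty set \<open>S\<close> of rows in which it has its ones; with
  \<open>S = {}\<close> for the empty row, either case multiplies the permutation by the cycle through \<open>S\<close> and
  the new label (\<open>phi_extend\<close>). The Le-condition restricts \<open>S\<close> to the rows whose zeros have
  no 1 above them, and these sit at the left-to-right maxima of the permutation
  (\<open>free_rows_lr_max\<close>). On permutations the same step can be undone in exactly one way: \<open>S\<close>
  consists of the left-to-right maxima with a value above the last letter (\<open>cyc_bij\<close>).

  \<open>Psi\<close> is bijective. A row is read only when it has no 0 left and a column only when it has no 1
  left, so the entry in a row and a column is 1 iff the row is read first. Thus \<open>Psi N\<close>
  determines \<open>N\<close>. Conversely any word defines a filling in this way; a forbidden rectangle would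
  be a cycle in the linear order of the word, so the filling is a NEW-tableau. Its reading word has
  the same descent bottoms and the same relative order of each row and the columns that meet it,
  and these data determine a permutation (\<open>perms_determined\<close>).
\<close>

section \<open>Tableaux built along the border\<close>

text \<open>
  Le-tableaux and NEW-tableaux are both of this kind, and the class is closed under removal of the
  last border step, so that it supports induction along the border.
\<close>

definition covered :: "nat \<Rightarrow> tableau set" where
  "covered n = {T. ferrers T \<and> every_col_has_one T \<and> tableau_size T = n}"

definition row_labels :: "tableau \<Rightarrow> nat set" where
  "row_labels T = (\<lambda>i. label T (Vert i)) ` {..<length T}"

text \<open>
  Cells are named by labels, because a new border step leaves the labels of all others unchanged,
  whereas a new leftmost column shifts every column index.
\<close>

definition ones :: "tableau \<Rightarrow> (nat \<times> nat) set" where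
  "ones T = {(label T (Vert i), label T (Horiz j)) | i j. has_one T i j}"

text \<open>
  One parameter covers both kinds of last border step: a column must contain a 1, so the empty set
  is free to stand for an empty bottom row.
\<close>

definition extend :: "tableau \<Rightarrow> nat set \<Rightarrow> tableau" where
  "extend T S = (if S = {} then T @ [[]]
                 else map (\<lambda>i. (label T (Vert i) \<in> S) # T ! i) [0..<length T])"

fun shift_col :: "border_step \<Rightarrow> border_step" where
  "shift_col (Vert i) = Vert i"
| "shift_col (Horiz j) = Horiz (Suc j)"

lemma inj_shift_col: "inj shift_col"
proof (rule injI)
  fix x y show "shift_col x = shift_col y \<Longrightarrow> x = y" by (cases x; cases y) auto
qed

lemma label_nth:
  assumes "s \<in> set (border T)"
  shows "label T s \<in> {1..length (border T)}" "border T ! (label T s - 1) = s"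
proof -
  let ?t = "takeWhile (\<lambda>s'. s' \<noteq> s) (border T)"
  have l: "length ?t < length (border T)"
    using assms by (metis (mono_tags, lifting) length_takeWhile_le nat_less_le set_takeWhileD takeWhile_eq_take take_all_iff le_refl)
  show "label T s \<in> {1..length (border T)}" using l by (auto simp: label_def)
  have "\<not> (border T ! length ?t \<noteq> s)" using nth_length_takeWhile[OF l] by blast
  then show "border T ! (label T s - 1) = s" by (simp add: label_def)
qed

lemma label_inj:
  assumes "s \<in> set (border T)" "s' \<in> set (border T)" "label T s = label T s'"
  shows "s = s'"
  using label_nth(2)[OF assms(1)] label_nth(2)[OF assms(2)] assms(3) by simp

lemma label_of_nth:
  assumes "distinct (border T)" "k < length (border T)"
  shows "label T (border T ! k) = Suc k"
proof -
  have s: "border T ! k \<in> set (border T)" using assms(2) by simp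
  have "label T (border T ! k) - 1 < length (border T)" using label_nth(1)[OF s] by auto
  then have "label T (border T ! k) - 1 = k"
    using label_nth(2)[OF s] assms nth_eq_iff_index_eq by blast
  then show ?thesis using label_nth(1)[OF s] by auto
qed

lemma Vert_in_border: "i < length T \<Longrightarrow> Vert i \<in> set (border T)"
  by (auto simp: border_def num_rows_def)

lemma label_Vert_eq: "i < length T \<Longrightarrow> i' < length T \<Longrightarrow> label T (Vert i) = label T (Vert i') \<Longrightarrow> i = i'"
  using label_inj[OF Vert_in_border Vert_in_border] by blast

lemma takeWhile_map_inj:
  "inj f \<Longrightarrow> length (takeWhile (\<lambda>s'. s' \<noteq> f s) (map f xs)) = length (takeWhile (\<lambda>s'. s' \<noteq> s) xs)"
  by (induction xs) (auto simp: inj_eq)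

lemma takeWhile_neq_append:
  "s \<in> set xs \<Longrightarrow> length (takeWhile (\<lambda>s'. s' \<noteq> s) (xs @ ys)) = length (takeWhile (\<lambda>s'. s' \<noteq> s) xs)"
  by (induction xs) auto

lemma takeWhile_neq_fresh:
  "s \<notin> set xs \<Longrightarrow> length (takeWhile (\<lambda>s'. s' \<noteq> s) (xs @ s # ys)) = length xs"
  by (induction xs) auto

lemma length_extend: "length (extend T S) = (if S = {} then Suc (length T) else length T)"
  by (simp add: extend_def)

lemma in_diagram_extend_empty: "in_diagram (extend T {}) i j \<longleftrightarrow> in_diagram T i j"
  by (auto simp: in_diagram_def extend_def nth_append)

lemma has_one_extend_empty: "has_one (extend T {}) i j \<longleftrightarrow> has_one T i j"
  by (auto simp: has_one_def in_diagram_def extend_def nth_append)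

lemma in_diagram_extend_0:
  "S \<noteq> {} \<Longrightarrow> in_diagram (extend T S) i 0 \<longleftrightarrow> i < length T"
  by (auto simp: in_diagram_def extend_def)

lemma in_diagram_extend_Suc:
  "S \<noteq> {} \<Longrightarrow> in_diagram (extend T S) i (Suc j) \<longleftrightarrow> in_diagram T i j"
  by (auto simp: in_diagram_def extend_def)

lemma has_one_extend_0:
  "S \<noteq> {} \<Longrightarrow> has_one (extend T S) i 0 \<longleftrightarrow> i < length T \<and> label T (Vert i) \<in> S"
  by (auto simp: has_one_def in_diagram_def extend_def)

lemma has_one_extend_Suc:
  "S \<noteq> {} \<Longrightarrow> has_one (extend T S) i (Suc j) \<longleftrightarrow> has_one T i j"
  by (auto simp: has_one_def in_diagram_def extend_def)

lemmas extend_cells = in_diagram_extend_empty has_one_extend_empty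
  in_diagram_extend_0 in_diagram_extend_Suc has_one_extend_0 has_one_extend_Suc

lemma num_cols_nth: "T \<noteq> [] \<Longrightarrow> num_cols T = length (T ! 0)"
  by (cases T) (auto simp: num_cols_def)

lemma num_cols_extend:
  "S \<subseteq> row_labels T \<Longrightarrow> num_cols (extend T S) = (if S = {} then num_cols T else Suc (num_cols T))"
  by (cases T) (auto simp: num_cols_def extend_def row_labels_def upt_conv_Cons simp del: upt_Suc)

lemma size_extend:
  "S \<subseteq> row_labels T \<Longrightarrow> tableau_size (extend T S) = Suc (tableau_size T)"
  by (simp add: tableau_size_def num_cols_extend num_rows_def length_extend)

lemma ferrers_iff: "ferrers T \<longleftrightarrow> (\<forall>i i'. i < i' \<longrightarrow> i' < length T \<longrightarrow> length (T ! i') \<le> length (T ! i))"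
  by (auto simp: ferrers_def shape_def sorted_wrt_iff_nth_less)

lemma ferrers_extend: "ferrers T \<Longrightarrow> ferrers (extend T S)"
  by (auto simp: ferrers_iff extend_def nth_append)

lemma in_diagram_num_cols: "ferrers T \<Longrightarrow> in_diagram T i j \<Longrightarrow> j < num_cols T"
  unfolding ferrers_iff in_diagram_def
  by (cases "i = 0"; cases T) (auto simp: num_cols_def, fastforce)

lemma extend_covered:
  assumes "T \<in> covered n" "S \<subseteq> row_labels T"
  shows "extend T S \<in> covered (Suc n)"
proof -
  have T: "ferrers T" "every_col_has_one T" "tableau_size T = n" using assms(1) by (auto simp: covered_def)
  have "every_col_has_one (extend T S)"
  proof (cases "S = {}")
    case True
    have nc: "num_cols (extend T {}) = num_cols T" by (simp add: num_cols_extend)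
    show ?thesis unfolding True every_col_has_one_def nc
    proof (intro allI impI)
      fix j assume "j < num_cols T"
      then obtain i where i: "i < length T" "has_one T i j"
        using T(2) unfolding every_col_has_one_def num_rows_def by blast
      show "\<exists>i<num_rows (extend T {}). has_one (extend T {}) i j"
        using i by (intro exI[of _ i]) (simp add: num_rows_def length_extend has_one_extend_empty)
    qed
  next
    case False
    then obtain i0 where i0: "i0 < length T" "label T (Vert i0) \<in> S"
      using assms(2) by (auto simp: row_labels_def)
    have nc: "num_cols (extend T S) = Suc (num_cols T)" using False assms(2) by (simp add: num_cols_extend)
    have nr: "num_rows (extend T S) = length T" using False by (simp add: num_rows_def length_extend)
    show ?thesis unfolding every_col_has_one_def nc nr
    proof (intro allI impI)
      fix j assume j: "j < Suc (num_cols T)"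
      show "\<exists>i<length T. has_one (extend T S) i j"
      proof (cases j)
        case 0
        then show ?thesis using i0 False by (auto simp: has_one_extend_0)
      next
        case (Suc k)
        then obtain i where "i < length T" "has_one T i k"
          using T(2) j unfolding every_col_has_one_def num_rows_def by blast
        then show ?thesis using Suc False by (auto simp: has_one_extend_Suc)
      qed
    qed
  qed
  then show ?thesis using T assms by (simp add: covered_def ferrers_extend size_extend)
qed

lemma covered_0: "covered 0 = {[]}"
  by (auto simp: covered_def ferrers_def every_col_has_one_def tableau_size_def num_rows_def num_cols_def shape_def)

text \<open>
  The last border step is vertical iff the bottom row is empty. Otherwise it is the bottom of
  the leftmost column, which meets every row.
\<close>

lemma covered_SucE:
  assumes "T \<in> covered (Suc n)"
  obtains T' S where "T' \<in> covered n" "S \<subseteq> row_labels T'" "T = extend T' S"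
proof -
  have T: "ferrers T" "every_col_has_one T" "tableau_size T = Suc n" using assms by (auto simp: covered_def)
  have ne: "T \<noteq> []" using T(3) by (auto simp: tableau_size_def num_rows_def num_cols_def)
  show thesis
  proof (cases "last T = []")
    case True
    let ?T = "butlast T"
    have eq: "T = extend ?T {}" using True ne by (simp add: extend_def) (metis append_butlast_last_id)
    have nc: "num_cols T = num_cols ?T" using num_cols_extend[of "{}" ?T] eq by simp
    have nr: "length T = Suc (length ?T)" using ne by simp
    have ho: "has_one T i j = has_one ?T i j" for i j using has_one_extend_empty[of ?T] eq by simp
    have "ferrers ?T" using T(1) by (auto simp: ferrers_iff nth_butlast)
    moreover have "every_col_has_one ?T"
      unfolding every_col_has_one_def num_rows_def
    proof (intro allI impI)
      fix j assume "j < num_cols ?T"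
      then obtain i where "has_one T i j" using T(2) unfolding every_col_has_one_def nc by blast
      then have *: "has_one ?T i j" using ho by blast
      then have "i < length ?T" unfolding has_one_def in_diagram_def by blast
      then show "\<exists>i<length ?T. has_one ?T i j" using * by blast
    qed
    moreover have "tableau_size ?T = n" using T(3) nr unfolding tableau_size_def num_rows_def nc by linarith
    ultimately have "?T \<in> covered n" by (simp add: covered_def)
    then show thesis using that[of ?T "{}"] eq by simp
  next
    case False
    have pos: "T ! i \<noteq> []" if "i < length T" for i
    proof -
      have "length (T ! (length T - 1)) \<le> length (T ! i)"
        using T(1) that unfolding ferrers_iff
        by (cases "i = length T - 1") auto
      then show ?thesis using False ne by (auto simp: last_conv_nth)
    qed
    let ?T = "map tl T"
    let ?S = "(\<lambda>i. label ?T (Vert i)) ` {i. i < length T \<and> T ! i ! 0}"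
    have c0: "0 < num_cols T" using pos[of 0] ne by (simp add: num_cols_nth)
    then obtain i0 where i0: "i0 < length T" "T ! i0 ! 0"
      using T(2) by (auto simp: every_col_has_one_def num_rows_def has_one_def)
    have Sne: "?S \<noteq> {}" using i0 by auto
    have Ssub: "?S \<subseteq> row_labels ?T" by (auto simp: row_labels_def)
    have "(label ?T (Vert i) \<in> ?S) = T ! i ! 0" if "i < length T" for i
      using that label_Vert_eq[of i ?T] by auto
    then have eq: "T = extend ?T ?S"
      using Sne pos by (auto simp: extend_def intro!: nth_equalityI) (metis hd_conv_nth list.collapse)+
    have nc: "num_cols T = Suc (num_cols ?T)"
      using num_cols_extend[OF Ssub] Sne eq by simp
    have ho: "has_one T i (Suc j) = has_one ?T i j" for i j using has_one_extend_Suc[OF Sne, of ?T] eq by simp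
    have "ferrers ?T" using T(1) by (auto simp: ferrers_iff intro: diff_le_mono)
    moreover have "every_col_has_one ?T"
      using T(2) by (auto simp: every_col_has_one_def nc num_rows_def ho[symmetric])
    moreover have "tableau_size ?T = n" using T(3) nc by (simp add: tableau_size_def num_rows_def)
    ultimately have "?T \<in> covered n" by (simp add: covered_def)
    then show thesis using that[OF _ Ssub eq] by blast
  qed
qed

lemma border_extend_empty: "border (extend T {}) = border T @ [Vert (length T)]"
proof -
  have rl: "row_length (extend T {}) i = row_length T i" for i
    by (auto simp: row_length_def extend_def nth_append)
  show ?thesis
    by (simp add: border_def num_rows_def length_extend rl) (simp add: row_length_def)
qed

lemma rev_upt_Suc_shift: "rev [Suc a..<Suc b] = map Suc (rev [a..<b])"
  by (metis map_Suc_upt rev_map)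

lemma rev_upt_0_Suc: "rev [0..<Suc b] = map Suc (rev [0..<b]) @ [0]"
  by (metis map_Suc_upt rev.simps(2) rev_map upt_conv_Cons zero_less_Suc)

lemma border_extend:
  assumes "S \<noteq> {}" "S \<subseteq> row_labels T"
  shows "border (extend T S) = map shift_col (border T) @ [Horiz 0]"
proof -
  have ne: "T \<noteq> []" using assms by (auto simp: row_labels_def)
  then obtain p where p: "length T = Suc p" by (cases T) auto
  let ?T = "extend T S"
  have rl: "row_length ?T i = Suc (row_length T i)" if "i \<le> p" for i
    using that assms(1) p by (auto simp: row_length_def extend_def simp del: upt_Suc)
  have rl0: "row_length ?T (Suc p) = 0" "row_length T (Suc p) = 0"
    using assms(1) p by (auto simp: row_length_def length_extend)
  let ?f = "\<lambda>T i. Vert i # map Horiz (rev [row_length T (Suc i)..<row_length T i])"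
  have 1: "map (?f ?T) [0..<p] = map (map shift_col \<circ> ?f T) [0..<p]"
    by (rule map_cong) (simp_all add: rl rev_upt_Suc_shift del: upt_Suc)
  have 2: "?f ?T p = map shift_col (?f T p) @ [Horiz 0]"
    by (simp only: rl0 rl[OF order.refl] rev_upt_0_Suc) simp
  have "border ?T = concat (map (?f ?T) [0..<p]) @ ?f ?T p"
    using assms(1) p by (simp add: border_def num_rows_def length_extend)
  also have "\<dots> = map shift_col (border T) @ [Horiz 0]"
    unfolding 1 2 border_def num_rows_def p by (simp add: map_concat)
  finally show ?thesis .
qed

lemma border_covered:
  "T \<in> covered n \<Longrightarrow> distinct (border T) \<and> length (border T) = n \<and>
     set (border T) = Vert ` {..<length T} \<union> Horiz ` {..<num_cols T}"
proof (induction n arbitrary: T)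
  case 0
  then show ?case by (simp add: covered_0 border_def num_rows_def num_cols_def)
next
  case (Suc n)
  then obtain T' S where T': "T' \<in> covered n" "S \<subseteq> row_labels T'" "T = extend T' S"
    using covered_SucE by blast
  note IH = Suc.IH[OF T'(1)]
  show ?case
  proof (cases "S = {}")
    case True
    then show ?thesis using IH T'
      by (auto simp: border_extend_empty length_extend num_cols_extend lessThan_Suc)
  next
    case False
    have "distinct (map shift_col (border T'))"
      using IH inj_shift_col by (simp add: distinct_map inj_on_def inj_def)
    moreover have "Horiz 0 \<noteq> shift_col s" for s by (cases s) auto
    moreover have "shift_col ` (Vert ` A \<union> Horiz ` B) = Vert ` A \<union> Horiz ` Suc ` B" for A B
      by (force simp: image_Un image_image)
    ultimately show ?thesis using IH T' False
      by (auto simp: border_extend length_extend num_cols_extend lessThan_Suc_eq_insert_0)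
  qed
qed

lemma label_extend_empty:
  assumes "T \<in> covered n"
  shows "s \<in> set (border T) \<Longrightarrow> label (extend T {}) s = label T s"
    and "label (extend T {}) (Vert (length T)) = Suc n"
  using border_covered[OF assms] takeWhile_neq_fresh[of "Vert (length T)" "border T" "[]"]
  by (auto simp: label_def border_extend_empty takeWhile_neq_append)

lemma label_extend:
  assumes "T \<in> covered n" "S \<noteq> {}" "S \<subseteq> row_labels T"
  shows "s \<in> set (border T) \<Longrightarrow> label (extend T S) (shift_col s) = label T s"
    and "label (extend T S) (Horiz 0) = Suc n"
proof -
  show "label (extend T S) (shift_col s) = label T s" if "s \<in> set (border T)"
    using that takeWhile_map_inj[OF inj_shift_col, of s "border T"]
    by (simp add: label_def border_extend[OF assms(2,3)] takeWhile_neq_append)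
  have "Horiz 0 \<notin> set (map shift_col (border T))" 
  proof
    assume "Horiz 0 \<in> set (map shift_col (border T))"
    then obtain s where "Horiz 0 = shift_col s" by auto
    then show False by (cases s) auto
  qed
  then show "label (extend T S) (Horiz 0) = Suc n"
    using takeWhile_neq_fresh[of "Horiz 0" "map shift_col (border T)" "[]"] border_covered[OF assms(1)]
    by (simp add: label_def border_extend[OF assms(2,3)])
qed

lemma label_bij: "T \<in> covered n \<Longrightarrow> bij_betw (label T) (set (border T)) {1..n}"
proof -
  assume T: "T \<in> covered n"
  note b = border_covered[OF T]
  have "inj_on (label T) (set (border T))" using label_inj by (auto simp: inj_on_def)
  moreover have "label T ` set (border T) \<subseteq> {1..n}" using label_nth(1)[of _ T] b by auto
  moreover have "k \<in> label T ` set (border T)" if "k \<in> {1..n}" for k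
    using label_of_nth[of T "k - 1"] b that by (intro image_eqI[of _ _ "border T ! (k-1)"]) auto
  ultimately show ?thesis by (auto simp: bij_betw_def)
qed

lemma row_labels_sub: "T \<in> covered n \<Longrightarrow> row_labels T \<subseteq> {1..n}"
  using label_bij[of T n] border_covered[of T n] by (auto simp: row_labels_def bij_betw_def)

lemma label_range: 
  assumes "T \<in> covered n"
  shows "i < length T \<Longrightarrow> label T (Vert i) \<in> {1..n}" "j < num_cols T \<Longrightarrow> label T (Horiz j) \<in> {1..n}"
  using label_bij[OF assms] border_covered[OF assms] by (auto simp: bij_betw_def)

text \<open>
  A row and a column meet iff the border passes the end of the row before the bottom of the
  column. This is why the diagram can be replaced by the labels from here on.
\<close>

lemma label_order_aux:
  "T \<in> covered n \<Longrightarrow>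
     (i < i' \<longrightarrow> i' < length T \<longrightarrow> label T (Vert i) < label T (Vert i')) \<and>
     (j < j' \<longrightarrow> j' < num_cols T \<longrightarrow> label T (Horiz j') < label T (Horiz j)) \<and>
     (i < length T \<longrightarrow> j < num_cols T \<longrightarrow> in_diagram T i j = (label T (Vert i) < label T (Horiz j)))"
proof (induction n arbitrary: T i i' j j')
  case 0
  then show ?case by (simp add: covered_0 num_cols_def)
next
  case (Suc n)
  obtain T' S where T': "T' \<in> covered n" "S \<subseteq> row_labels T'" "T = extend T' S"
    using covered_SucE[OF Suc.prems] by blast
    have IH1: "i < i' \<Longrightarrow> i' < length T' \<Longrightarrow> label T' (Vert i) < label T' (Vert i')"
      and IH2: "j < j' \<Longrightarrow> j' < num_cols T' \<Longrightarrow> label T' (Horiz j') < label T' (Horiz j)"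
      and IH3: "i < length T' \<Longrightarrow> j < num_cols T' \<Longrightarrow>
        in_diagram T' i j \<longleftrightarrow> label T' (Vert i) < label T' (Horiz j)" for i i' j j'
      using Suc.IH[of T' i i' j j'] T'(1) by blast+
    note b = border_covered[OF T'(1)]
    note le = label_range[OF T'(1)]
    show ?case
    proof (cases "S = {}")
      case True
      have v: "label (extend T' {}) (Vert i) = (if i = length T' then Suc n else label T' (Vert i))"
        if "i \<le> length T'" for i
        using that label_extend_empty[OF T'(1)] b by auto
      have h: "label (extend T' {}) (Horiz j) = label T' (Horiz j)" if "j < num_cols T'" for j
        using that label_extend_empty[OF T'(1)] b by auto
      have nd: "\<not> in_diagram T' (length T') j" by (simp add: in_diagram_def)
      have len: "length (extend T' {}) = Suc (length T')" "num_cols (extend T' {}) = num_cols T'"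
        by (simp_all add: length_extend num_cols_extend)
      show ?thesis unfolding T'(3) True len
      proof (intro conjI impI)
        assume "i < i'" "i' < Suc (length T')"
        then show "label (extend T' {}) (Vert i) < label (extend T' {}) (Vert i')"
          using IH1[of i i'] le(1)[of i] by (auto simp: v less_Suc_eq)
      next
        assume "j < j'" "j' < num_cols T'"
        then show "label (extend T' {}) (Horiz j') < label (extend T' {}) (Horiz j)"
          using IH2[of j j'] by (simp add: h)
      next
        assume "i < Suc (length T')" "j < num_cols T'"
        then show "in_diagram (extend T' {}) i j \<longleftrightarrow>
            label (extend T' {}) (Vert i) < label (extend T' {}) (Horiz j)"
          using IH3[of i j] le(2)[of j] nd by (cases "i = length T'") (auto simp: v h in_diagram_extend_empty)
      qed
    next
      case False
      have v: "label (extend T' S) (Vert i) = label T' (Vert i)" if "i < length T'" for i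
        using that label_extend(1)[OF T'(1) False T'(2), of "Vert i"] b by auto
      have h: "label (extend T' S) (Horiz (Suc j)) = label T' (Horiz j)" if "j < num_cols T'" for j
        using that label_extend(1)[OF T'(1) False T'(2), of "Horiz j"] b by auto
      note h0 = label_extend(2)[OF T'(1) False T'(2)]
      have len: "length (extend T' S) = length T'" "num_cols (extend T' S) = Suc (num_cols T')"
        using False T'(2) by (simp_all add: length_extend num_cols_extend)
      show ?thesis unfolding T'(3) len
      proof (intro conjI impI)
        assume "i < i'" "i' < length T'"
        then show "label (extend T' S) (Vert i) < label (extend T' S) (Vert i')"
          using IH1[of i i'] by (simp add: v)
      next
        assume *: "j < j'" "j' < Suc (num_cols T')"
        then obtain k' where k': "j' = Suc k'" "k' < num_cols T'" by (cases j') auto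
        show "label (extend T' S) (Horiz j') < label (extend T' S) (Horiz j)"
          using * k' le(2)[of k'] IH2[of _ k'] by (cases j) (auto simp: h h0)
      next
        assume "i < length T'" "j < Suc (num_cols T')"
        then show "in_diagram (extend T' S) i j \<longleftrightarrow>
            label (extend T' S) (Vert i) < label (extend T' S) (Horiz j)"
          using IH3[of i] le(1)[of i] False
          by (cases j) (auto simp: v h h0 in_diagram_extend_0 in_diagram_extend_Suc)
      qed
    qed
qed

lemma label_order:
  assumes "T \<in> covered n"
  shows "i < i' \<Longrightarrow> i' < length T \<Longrightarrow> label T (Vert i) < label T (Vert i')"
    and "j < j' \<Longrightarrow> j' < num_cols T \<Longrightarrow> label T (Horiz j') < label T (Horiz j)"
    and "i < length T \<Longrightarrow> j < num_cols T \<Longrightarrow> in_diagram T i j \<longleftrightarrow> label T (Vert i) < label T (Horiz j)"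
  using label_order_aux[OF assms] by blast+

lemma row_labels_extend:
  assumes "T \<in> covered n" "S \<subseteq> row_labels T"
  shows "row_labels (extend T S) = (if S = {} then insert (Suc n) (row_labels T) else row_labels T)"
proof (cases "S = {}")
  case True
  have "label (extend T {}) (Vert i) = (if i = length T then Suc n else label T (Vert i))" if "i < Suc (length T)" for i
    using that label_extend_empty[OF assms(1)] border_covered[OF assms(1)] by auto
  then show ?thesis using True by (auto simp: row_labels_def length_extend lessThan_Suc)
next
  case False
  have "label (extend T S) (Vert i) = label T (Vert i)" if "i < length T" for i
    using that label_extend(1)[OF assms(1) False assms(2), of "Vert i"] border_covered[OF assms(1)] by auto
  then show ?thesis using False by (auto simp: row_labels_def length_extend)
qed

lemma has_one_bounds: "ferrers T \<Longrightarrow> has_one T i j \<Longrightarrow> i < length T \<and> j < num_cols T"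
  using in_diagram_num_cols by (auto simp: has_one_def in_diagram_def)

lemma ones_extend:
  assumes "T \<in> covered n" "S \<subseteq> row_labels T"
  shows "ones (extend T S) = ones T \<union> S \<times> {Suc n}"
proof -
  have f: "ferrers T" using assms by (simp add: covered_def)
  note b = border_covered[OF assms(1)]
  show ?thesis
  proof (cases "S = {}")
    case True
    have "label (extend T {}) (Vert i) = label T (Vert i)" "label (extend T {}) (Horiz j) = label T (Horiz j)"
      if "has_one T i j" for i j
      using label_extend_empty(1)[OF assms(1)] has_one_bounds[OF f that] b by auto
    then show ?thesis using True by (force simp: ones_def has_one_extend_empty)
  next
    case False
    have v: "label (extend T S) (Vert i) = label T (Vert i)" if "i < length T" for i
      using that label_extend(1)[OF assms(1) False assms(2), of "Vert i"] b by auto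
    have h: "label (extend T S) (Horiz (Suc j)) = label T (Horiz j)" if "j < num_cols T" for j
      using that label_extend(1)[OF assms(1) False assms(2), of "Horiz j"] b by auto
    have h0: "label (extend T S) (Horiz 0) = Suc n" using label_extend(2)[OF assms(1) False assms(2)] .
    have vh: "label (extend T S) (Vert i) = label T (Vert i) \<and> label (extend T S) (Horiz (Suc j)) = label T (Horiz j)"
      if "has_one T i j" for i j using v h has_one_bounds[OF f that] by blast
    show ?thesis
    proof (intro equalityI subsetI)
      fix x assume "x \<in> ones (extend T S)"
      then obtain i j where x: "x = (label (extend T S) (Vert i), label (extend T S) (Horiz j))"
        and ij: "has_one (extend T S) i j" by (auto simp: ones_def)
      show "x \<in> ones T \<union> S \<times> {Suc n}"
      proof (cases j)
        case 0
        then show ?thesis using x ij v[of i] False by (auto simp: has_one_extend_0 h0)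
      next
        case (Suc k)
        then have "has_one T i k" using ij False by (simp add: has_one_extend_Suc)
        then show ?thesis using vh x Suc by (auto simp: ones_def)
      qed
    next
      fix x assume x: "x \<in> ones T \<union> S \<times> {Suc n}"
      show "x \<in> ones (extend T S)"
      proof (cases "x \<in> ones T")
        case True
        then obtain i j where "x = (label T (Vert i), label T (Horiz j))" "has_one T i j"
          by (auto simp: ones_def)
        then have "x = (label (extend T S) (Vert i), label (extend T S) (Horiz (Suc j)))"
          "has_one (extend T S) i (Suc j)" using vh False by (auto simp: has_one_extend_Suc)
        then show ?thesis by (auto simp: ones_def)
      next
        case nT: False
        then obtain i where i: "i < length T" "label T (Vert i) \<in> S" "x = (label T (Vert i), Suc n)"
          using x assms(2) by (auto simp: row_labels_def)
        then have "x = (label (extend T S) (Vert i), label (extend T S) (Horiz 0))"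
          "has_one (extend T S) i 0" using v h0 False by (auto simp: has_one_extend_0)
        then show ?thesis by (auto simp: ones_def)
      qed
    qed
  qed
qed

lemma ones_range: "T \<in> covered n \<Longrightarrow> ones T \<subseteq> {1..n} \<times> {1..n}"
proof
  fix x assume T: "T \<in> covered n" and "x \<in> ones T"
  then obtain i j where "x = (label T (Vert i), label T (Horiz j))" "has_one T i j"
    by (auto simp: ones_def)
  then show "x \<in> {1..n} \<times> {1..n}"
    using label_range[OF T] has_one_bounds[of T i j] T by (simp add: covered_def)
qed

section \<open>Multiplying a permutation by a cycle through left-to-right maxima\<close>

text \<open>
  The cycle that sends each element of \<open>S\<close> to the next larger one, the largest to \<open>N\<close>, and \<open>N\<close> to
  the smallest; it is meant for \<open>S\<close> below \<open>N\<close>, and it is the identity if \<open>S\<close> is empty.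
\<close>

definition cyc :: "nat set \<Rightarrow> nat \<Rightarrow> nat \<Rightarrow> nat" where
  "cyc S N k = (if k = N then Min (insert N S)
                else if k \<in> S then Min {s \<in> insert N S. k < s} else k)"

definition lr_max :: "nat \<Rightarrow> (nat \<Rightarrow> nat) \<Rightarrow> nat set" where
  "lr_max N f = {k \<in> {1..N}. \<forall>j\<in>{1..<k}. f j < f k}"

lemma lr_maxD: "k \<in> lr_max N f \<Longrightarrow> 1 \<le> j \<Longrightarrow> j < k \<Longrightarrow> f j < f k"
  by (auto simp: lr_max_def)

lemma lr_max_sub: "lr_max N f \<subseteq> {1..N}"
  by (auto simp: lr_max_def)

lemma cyc_last:
  assumes "S \<subseteq> {1..n}"
  shows "cyc S (Suc n) (Suc n) \<in> insert (Suc n) S" "s \<in> insert (Suc n) S \<Longrightarrow> cyc S (Suc n) (Suc n) \<le> s"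
proof -
  have "finite (insert (Suc n) S)" using assms finite_subset by auto
  moreover have "cyc S (Suc n) (Suc n) = Min (insert (Suc n) S)" by (simp add: cyc_def)
  ultimately show "cyc S (Suc n) (Suc n) \<in> insert (Suc n) S" "s \<in> insert (Suc n) S \<Longrightarrow> cyc S (Suc n) (Suc n) \<le> s"
    using Min_in[of "insert (Suc n) S"] Min_le[of "insert (Suc n) S" s] by auto
qed

lemma cyc_next:
  assumes "S \<subseteq> {1..n}" "k \<in> S"
  shows "cyc S (Suc n) k \<in> insert (Suc n) S" "k < cyc S (Suc n) k"
    "s \<in> insert (Suc n) S \<Longrightarrow> k < s \<Longrightarrow> cyc S (Suc n) k \<le> s"
proof -
  let ?A = "{s \<in> insert (Suc n) S. k < s}"
  have f: "finite ?A" using assms(1) finite_subset[of S "{1..n}"] by auto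
  have "Suc n \<in> ?A" using assms by force
  then have "Min ?A \<in> ?A" using Min_in[OF f] by blast
  moreover have "cyc S (Suc n) k = Min ?A" using assms by (auto simp: cyc_def)
  ultimately show "cyc S (Suc n) k \<in> insert (Suc n) S" "k < cyc S (Suc n) k"
    "s \<in> insert (Suc n) S \<Longrightarrow> k < s \<Longrightarrow> cyc S (Suc n) k \<le> s"
    using Min_le[OF f] by auto
qed

lemma cyc_out: "k \<notin> insert N S \<Longrightarrow> cyc S N k = k"
  by (simp add: cyc_def)

lemma cyc_empty: "cyc {} N = id"
  by (auto simp: cyc_def)

lemma cyc_permutes:
  assumes "S \<subseteq> {1..n}"
  shows "cyc S (Suc n) permutes {1..Suc n}"
proof (rule bij_imp_permutes)
  let ?c = "cyc S (Suc n)"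
  note last = cyc_last[OF assms] and nxt = cyc_next[OF assms]
  have range: "?c ` {1..Suc n} \<subseteq> {1..Suc n}"
  proof
    fix y assume "y \<in> ?c ` {1..Suc n}"
    then obtain k where k: "k \<in> {1..Suc n}" "y = ?c k" by auto
    have sub: "insert (Suc n) S \<subseteq> {1..Suc n}" using assms by auto
    show "y \<in> {1..Suc n}"
    proof (cases "k \<in> insert (Suc n) S")
      case True
      then have "y \<in> insert (Suc n) S" using last(1) nxt(1) k(2) by blast
      then show ?thesis using sub by blast
    next
      case False
      then show ?thesis using k cyc_out by metis
    qed
  qed
  have ne: "?c k \<noteq> ?c k'" if "k < k'" for k k'
  proof -
    have "k = Suc n \<Longrightarrow> k' \<notin> insert (Suc n) S" using that assms by auto
    then consider "k \<in> S" "k' \<in> S" | "k \<in> S" "k' = Suc n" | "k \<notin> S" "k \<noteq> Suc n" "k' \<in> insert (Suc n) S"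
      | "k' \<notin> insert (Suc n) S" "k \<in> insert (Suc n) S" | "k \<notin> insert (Suc n) S" "k' \<notin> insert (Suc n) S"
      by blast
    then show ?thesis
    proof cases
      case 1
      then show ?thesis using nxt(3)[of k k'] nxt(2)[of k'] that by fastforce
    next
      case 2
      then show ?thesis using last(2)[of k] nxt(2)[of k] by fastforce
    next
      case 3
      then have "?c k' \<in> insert (Suc n) S" using last(1) nxt(1) by blast
      then show ?thesis using 3 cyc_out[of k "Suc n" S] by auto
    next
      case 4
      then have "?c k \<in> insert (Suc n) S" using last(1) nxt(1) by blast
      then show ?thesis using 4 cyc_out[of k' "Suc n" S] by auto
    next
      case 5
      then show ?thesis using that by (simp add: cyc_out)
    qed
  qed
  have "inj_on ?c {1..Suc n}"
  proof (rule inj_onI)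
    fix x y assume "?c x = ?c y"
    then show "x = y" using ne[of x y] ne[of y x] by (cases x y rule: linorder_cases) auto
  qed
  then show "bij_betw ?c {1..Suc n} {1..Suc n}"
    using endo_inj_surj[OF _ range] by (simp add: bij_betw_def)
  show "?c x = x" if "x \<notin> {1..Suc n}" for x
    using that assms by (intro cyc_out) auto
qed

lemma permutes_atLeast1:
  fixes n k :: nat
  assumes "f permutes {1..n}" "1 \<le> k"
  shows "1 \<le> f k" "k \<le> n \<Longrightarrow> f k \<le> n" "n < k \<Longrightarrow> f k = k"
proof -
  have *: "k \<le> n \<Longrightarrow> f k \<in> {1..n}" using permutes_in_image[OF assms(1), of k] assms(2) by simp
  show c: "f k = k" if "n < k"
  proof -
    have "k \<notin> {1..n}" using that by auto
    then show ?thesis using permutes_not_in[OF assms(1)] by blast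
  qed
  show "1 \<le> f k" using * c assms(2) by (cases "k \<le> n") auto
  show "k \<le> n \<Longrightarrow> f k \<le> n" using * by simp
qed

text \<open>
  The first position whose value exceeds \<open>v\<close> is a left-to-right maximum.
\<close>

lemma first_exceeding_lr_max:
  fixes f :: "nat \<Rightarrow> nat"
  assumes "1 \<le> j" "j \<le> N" "v < f j" "inj f"
  obtains k where "k \<in> lr_max N f" "k \<le> j" "v < f k"
proof -
  define k where "k = (LEAST k. 1 \<le> k \<and> v < f k)"
  have k: "1 \<le> k" "v < f k" using LeastI[of "\<lambda>k. 1 \<le> k \<and> v < f k" j] assms by (auto simp: k_def)
  have kj: "k \<le> j" using Least_le[of "\<lambda>k. 1 \<le> k \<and> v < f k" j] assms by (auto simp: k_def)
  have "f i < f k" if "1 \<le> i" "i < k" for i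
  proof -
    have "\<not> v < f i" using not_less_Least[of i "\<lambda>k. 1 \<le> k \<and> v < f k"] that by (auto simp: k_def)
    then show ?thesis using k(2) by simp
  qed
  then have "k \<in> lr_max N f" using k kj assms(2) by (auto simp: lr_max_def)
  then show thesis using that k kj by blast
qed

text \<open>
  Multiplying by the cycle raises the value at each element of \<open>S\<close> to the value of \<open>\<sigma>\<close> at the next
  one. So the elements of \<open>S\<close> stay left-to-right maxima, they hide all other maxima above the smallest
  of them, and all positions below \<open>S\<close> keep their values. If \<open>S\<close> is not empty, the last letter becomes the value of \<open>\<sigma>\<close>
  at the smallest element of \<open>S\<close>, which separates \<open>S\<close> from the maxima below it: hence \<open>S\<close> can be
  recovered.
\<close>

lemma lr_max_cyc:
  assumes s: "\<sigma> permutes {1..n}" and S: "S \<subseteq> lr_max n \<sigma>" and t: "\<tau> = \<sigma> \<circ> cyc S (Suc n)"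
  shows "lr_max (Suc n) \<tau> =
           (if S = {} then insert (Suc n) (lr_max n \<sigma>) else {r \<in> lr_max n \<sigma>. \<forall>s\<in>S. r < s} \<union> S)"
    and "S = {k \<in> lr_max (Suc n) \<tau>. \<tau> (Suc n) < \<tau> k}"
proof -
  let ?c = "cyc S (Suc n)"
  have Sn: "S \<subseteq> {1..n}" using S lr_max_sub by blast
  have fS: "finite S" using Sn finite_subset by blast
  note last = cyc_last[OF Sn] and nxt = cyc_next[OF Sn]
  have sN: "\<sigma> (Suc n) = Suc n" using permutes_atLeast1(3)[OF s] by simp
  have mono: "\<sigma> j < \<sigma> b" if "1 \<le> j" "j < b" "b \<in> insert (Suc n) S" for j b
  proof (cases "b = Suc n")
    case True
    then show ?thesis using permutes_atLeast1(2)[OF s, of j] that sN by simp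
  next
    case False
    then show ?thesis using that S lr_maxD by blast
  qed
  have mono_le: "\<sigma> j \<le> \<sigma> b" if "1 \<le> j" "j \<le> b" "b \<in> insert (Suc n) S" for j b
    using mono[OF that(1) _ that(3)] that(2) by (cases "j = b") auto
  have pos: "1 \<le> k" if "k \<in> insert (Suc n) S" for k using that Sn by auto
  have t_out: "\<tau> k = \<sigma> k" if "k \<notin> S" "k \<noteq> Suc n" for k using that by (simp add: t cyc_out)
  have t_S: "\<tau> k = \<sigma> (?c k)" for k by (simp add: t)
  have t_last: "\<tau> (Suc n) \<le> n" if ne: "S \<noteq> {}"
  proof -
    obtain x where x: "x \<in> S" using ne by blast
    then have "?c (Suc n) \<le> n" using last(2)[of x] Sn by force
    then show ?thesis using permutes_atLeast1(2)[OF s, of "?c (Suc n)"] pos[OF last(1)] by (simp add: t)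
  qed
  have S_lr: "r \<in> lr_max (Suc n) \<tau>" if r: "r \<in> S" for r
  proof -
    have "\<tau> j < \<tau> r" if j: "1 \<le> j" "j < r" for j
    proof (cases "j \<in> S")
      case True
      have "?c j < ?c r" using nxt(3)[OF True, of r] nxt(2)[OF r] j r by simp
      then show ?thesis using mono[OF _ _ nxt(1)[OF r]] pos[OF nxt(1)[OF True]] by (simp add: t_S)
    next
      case False
      then have "\<tau> j = \<sigma> j" using j r Sn t_out by force
      then show ?thesis using mono[OF j(1) _ nxt(1)[OF r]] nxt(2)[OF r] j by (simp add: t_S)
    qed
    then show ?thesis using r Sn by (auto simp: lr_max_def)
  qed
  have below: "(\<forall>s\<in>S. r < s) \<and> r \<in> lr_max n \<sigma>" if r: "r \<in> lr_max (Suc n) \<tau>" "r \<notin> S" "r \<noteq> Suc n" for r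
  proof -
    have r1: "1 \<le> r" "r \<le> n" using r by (auto simp: lr_max_def)
    have b: "r < x" if x: "x \<in> S" for x
    proof (rule ccontr)
      assume "\<not> r < x"
      then have "x < r" using x r by (metis linorder_neqE_nat)
      let ?A = "{x \<in> S. x < r}"
      have fA: "finite ?A" and nA: "?A \<noteq> {}" using fS x \<open>x < r\<close> by auto
      \<comment> \<open>the cycle carries the last element of \<open>S\<close> before \<open>r\<close> to an element beyond \<open>r\<close>\<close>
      define y where "y = Max ?A"
      have y: "y \<in> S" "y < r" using Max_in[OF fA nA] by (auto simp: y_def)
      have "r < ?c y"
      proof (rule ccontr)
        assume c: "\<not> r < ?c y"
        then have "?c y \<in> S" using nxt(1)[OF y(1)] r1 by auto
        moreover have "?c y \<noteq> r" using calculation r(2) by blast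
        ultimately have "?c y \<in> ?A" using c by auto
        then have "?c y \<le> y" using Max_ge[OF fA] by (simp add: y_def)
        then show False using nxt(2)[OF y(1)] by simp
      qed
      then have "\<sigma> r < \<tau> y" using mono[OF r1(1) _ nxt(1)[OF y(1)]] by (simp add: t_S)
      moreover have "\<tau> y < \<tau> r" using lr_maxD[OF r(1)] y Sn by auto
      ultimately show False using t_out[OF r(2,3)] by simp
    qed
    moreover have "\<sigma> j < \<sigma> r" if "1 \<le> j" "j < r" for j
    proof -
      have "j \<notin> S" using b that(2) by force
      then show ?thesis using lr_maxD[OF r(1) that] t_out[of j] t_out[OF r(2,3)] that r1 by simp
    qed
    ultimately show ?thesis using r1 by (auto simp: lr_max_def)
  qed
  have above: "r \<in> lr_max (Suc n) \<tau>" if r: "r \<in> lr_max n \<sigma>" "\<forall>s\<in>S. r < s" for r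
  proof -
    have "\<tau> j = \<sigma> j" if "1 \<le> j" "j \<le> r" for j
      using that r lr_max_sub[of n \<sigma>] by (intro t_out) force+
    then show ?thesis using r(1) by (auto simp: lr_max_def)
  qed
  have N: "Suc n \<in> lr_max (Suc n) \<tau> \<longleftrightarrow> S = {}"
  proof
    assume N: "Suc n \<in> lr_max (Suc n) \<tau>"
    show "S = {}"
    proof (rule ccontr)
      assume ne: "S \<noteq> {}"
      let ?m = "Max S"
      have m: "?m \<in> S" using fS ne by simp
      have "?c ?m = Suc n" using nxt(1,2)[OF m] Max_ge[OF fS, of "?c ?m"] by auto
      then have "\<tau> ?m = Suc n" by (simp add: t sN)
      moreover have "\<tau> ?m < \<tau> (Suc n)" using lr_maxD[OF N] m Sn by force
      ultimately show False using t_last[OF ne] by simp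
    qed
  next
    assume "S = {}"
    then have "\<tau> = \<sigma>" by (simp add: t cyc_empty)
    then show "Suc n \<in> lr_max (Suc n) \<tau>" using mono by (auto simp: lr_max_def)
  qed
  show "lr_max (Suc n) \<tau> =
           (if S = {} then insert (Suc n) (lr_max n \<sigma>) else {r \<in> lr_max n \<sigma>. \<forall>s\<in>S. r < s} \<union> S)"
  proof (cases "S = {}")
    case True
    then show ?thesis using N above below by auto
  next
    case False
    then show ?thesis using N above below S_lr by auto
  qed
  have gt: "\<tau> (Suc n) < \<tau> k" if k: "k \<in> S" for k
    using last(2)[of k] nxt(2)[OF k] k mono[OF pos[OF last(1)] _ nxt(1)[OF k]] by (simp add: t_S)
  have le: "k \<in> S" if k: "k \<in> lr_max (Suc n) \<tau>" "\<tau> (Suc n) < \<tau> k" for k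
  proof (rule ccontr)
    assume nS: "k \<notin> S"
    have kN: "k \<noteq> Suc n" using k by auto
    note b = below[OF k(1) nS kN]
    have k1: "1 \<le> k" "k \<le> n" using b lr_max_sub[of n \<sigma>] by auto
    then have "k \<le> ?c (Suc n)" using last(1) b by auto
    then have "\<sigma> k \<le> \<tau> (Suc n)" using mono_le[OF k1(1) _ last(1)] by (simp add: t_S)
    then show False using k(2) t_out[OF nS kN] by simp
  qed
  show "S = {k \<in> lr_max (Suc n) \<tau>. \<tau> (Suc n) < \<tau> k}" using S_lr gt le by blast
qed

text \<open>
  The preceding description of \<open>S\<close> defines it for an arbitrary \<open>\<tau>\<close>. Undoing the cycle gives the
  largest value back to the last position, because the position of that value is the largest
  element of \<open>S\<close>, or the last position itself if \<open>S\<close> is empty.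
\<close>

lemma lr_max_cyc_surj:
  assumes t: "\<tau> permutes {1..Suc n}" and S: "S = {k \<in> lr_max (Suc n) \<tau>. \<tau> (Suc n) < \<tau> k}"
  obtains \<sigma> where "\<sigma> permutes {1..n}" "S \<subseteq> lr_max n \<sigma>" "\<tau> = \<sigma> \<circ> cyc S (Suc n)"
proof -
  let ?c = "cyc S (Suc n)"
  define \<sigma> where "\<sigma> = \<tau> \<circ> inv ?c"
  have Sn: "S \<subseteq> {1..n}"
  proof
    fix k assume "k \<in> S"
    then have "k \<in> {1..Suc n}" "k \<noteq> Suc n" using S lr_max_sub[of "Suc n" \<tau>] by auto
    then show "k \<in> {1..n}" by auto
  qed
  have fS: "finite S" using Sn finite_subset by blast
  note last = cyc_last[OF Sn] and nxt = cyc_next[OF Sn]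
  note c = cyc_permutes[OF Sn]
  have injt: "inj \<tau>" using permutes_inj[OF t] .
  have sc: "\<sigma> (?c k) = \<tau> k" for k by (simp add: \<sigma>_def permutes_inverses(2)[OF c])
  have eq: "\<tau> = \<sigma> \<circ> ?c" using sc by auto
  have s_out: "\<sigma> k = \<tau> k" if "k \<notin> S" "k \<noteq> Suc n" for k using sc[of k] that by (simp add: cyc_out)
  have sp: "\<sigma> permutes {1..Suc n}" unfolding \<sigma>_def by (rule permutes_compose[OF permutes_inv[OF c] t])
  have sN: "\<sigma> (Suc n) = Suc n"
  proof -
    obtain p where p: "\<tau> p = Suc n" "p \<in> {1..Suc n}" using permutes_image[OF t]
      by (metis atLeastAtMost_iff image_iff le_add1 le_refl plus_1_eq_Suc)
    have le: "\<tau> k \<le> Suc n" if "k \<in> {1..Suc n}" for k using permutes_in_image[OF t, of k] that by simp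
    have lt: "\<tau> k < \<tau> p" if "k \<in> {1..Suc n}" "k \<noteq> p" for k
      using le[OF that(1)] injD[OF injt, of k p] that(2) p(1) by fastforce
    show ?thesis
    proof (cases "p = Suc n")
      case True
      have "S = {}"
      proof (rule ccontr)
        assume "S \<noteq> {}"
        then obtain k where "k \<in> S" by blast
        then show False using lt[of k] True Sn S by fastforce
      qed
      then show ?thesis using sc[of "Suc n"] p True by (simp add: cyc_empty)
    next
      case False
      have pS: "p \<in> S" unfolding S using p lt False by (auto simp: lr_max_def)
      have "?c p = Suc n"
      proof (rule ccontr)
        assume "?c p \<noteq> Suc n"
        then have q: "?c p \<in> S" using nxt(1)[OF pS] by auto
        then have "\<tau> p < \<tau> (?c p)" using lr_maxD[of "?c p" "Suc n" \<tau> p] nxt(2)[OF pS] pS Sn S by auto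
        then show False using lt[of "?c p"] q Sn nxt(2)[OF pS] by fastforce
      qed
      then show ?thesis using sc[of p] p by simp
    qed
  qed
  have sn: "\<sigma> permutes {1..n}"
  proof (rule permutes_superset[OF sp])
    show "\<sigma> x = x" if "x \<in> {1..Suc n} - {1..n}" for x using sN that by (auto simp: le_Suc_eq)
  qed
  have "s \<in> lr_max n \<sigma>" if s: "s \<in> S" for s
  proof -
    obtain k where k: "?c k = s" using c permutes_surj surj_def by metis
    have k': "k \<in> insert (Suc n) S" 
    proof (rule ccontr)
      assume a: "k \<notin> insert (Suc n) S"
      then have "k = s" using k cyc_out[OF a] by simp
      then show False using a s by simp
    qed
    have tN: "\<tau> (Suc n) \<le> \<tau> k" using k' S by auto
    have nb: "\<not> (x < s \<and> \<tau> k < \<tau> x)" if x: "x \<in> S" for x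
    proof
      assume a: "x < s \<and> \<tau> k < \<tau> x"
      show False
      proof (cases "k = Suc n")
        case True
        then show ?thesis using last(2)[of x] x k a by simp
      next
        case False
        then have kS: "k \<in> S" using k' by simp
        have "k < x"
        proof (rule ccontr)
          assume "\<not> k < x"
          moreover have "k \<noteq> x" using a by auto
          ultimately show False using lr_maxD[of k "Suc n" \<tau> x] kS S a x Sn by force
        qed
        then show ?thesis using nxt(3)[OF kS, of x] x k a by simp
      qed
    qed
    have "\<sigma> j < \<sigma> s" if j: "1 \<le> j" "j < s" for j
    proof -
      obtain i where i: "?c i = j" using c permutes_surj surj_def by metis
      have ss: "\<sigma> s = \<tau> k" "\<sigma> j = \<tau> i" using sc[of k] k sc[of i] i by auto
      have "\<not> \<tau> k < \<tau> i"
      proof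
        assume a: "\<tau> k < \<tau> i"
        show False
        proof (cases "i \<in> insert (Suc n) S")
          case True
          then have "i \<in> S" using a tN by auto
          then show False using nb[of i] nxt(2)[of i] i j a by simp
        next
          case False
          then have ij: "i = j" using i cyc_out by metis
          have jN: "j \<le> Suc n" using j s Sn by force
          obtain x where x: "x \<in> lr_max (Suc n) \<tau>" "x \<le> j" "\<tau> k < \<tau> x"
            using first_exceeding_lr_max[OF j(1) jN _ injt, of "\<tau> k"] a ij by blast
          then have "x \<in> S" using tN S by auto
          then show False using nb[of x] x j by simp
        qed
      qed
      moreover have "\<tau> k \<noteq> \<tau> i" using injD[OF injt, of k i] k i j by auto
      ultimately show ?thesis using ss by simp
    qed
    then show ?thesis using s Sn by (auto simp: lr_max_def)
  qed
  then show thesis using that[OF sn _ eq] by blast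
qed

lemma cyc_bij:
  "bij_betw (\<lambda>(\<sigma>, S). \<sigma> \<circ> cyc S (Suc n))
     (SIGMA \<sigma>:{\<sigma>. \<sigma> permutes {1..n}}. Pow (lr_max n \<sigma>)) {\<tau>. \<tau> permutes {1..Suc n}}"
  unfolding bij_betw_def
proof (intro conjI equalityI subsetI)
  show "inj_on (\<lambda>(\<sigma>, S). \<sigma> \<circ> cyc S (Suc n)) (SIGMA \<sigma>:{\<sigma>. \<sigma> permutes {1..n}}. Pow (lr_max n \<sigma>))"
  proof (rule inj_onI, clarify)
    fix \<sigma> S \<sigma>' S'
    assume a: "\<sigma> permutes {1..n}" "S \<subseteq> lr_max n \<sigma>" "\<sigma>' permutes {1..n}" "S' \<subseteq> lr_max n \<sigma>'"
      and e: "\<sigma> \<circ> cyc S (Suc n) = \<sigma>' \<circ> cyc S' (Suc n)"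
    have S: "S = S'" using lr_max_cyc(2)[OF a(1,2) refl] lr_max_cyc(2)[OF a(3,4) refl] e by metis
    have "S \<subseteq> {1..n}" using a(2) lr_max_sub by blast
    then have "surj (cyc S (Suc n))" using cyc_permutes permutes_surj by blast
    then have "\<sigma> k = \<sigma>' k" for k using fun_cong[OF e] S by (metis comp_apply surjD)
    then have "\<sigma> = \<sigma>'" by blast
    then show "\<sigma> = \<sigma>' \<and> S = S'" using S by simp
  qed
next
  fix \<tau> assume "\<tau> \<in> (\<lambda>(\<sigma>, S). \<sigma> \<circ> cyc S (Suc n)) ` (SIGMA \<sigma>:{\<sigma>. \<sigma> permutes {1..n}}. Pow (lr_max n \<sigma>))"
  then obtain \<sigma> S where "\<sigma> permutes {1..n}" "S \<subseteq> lr_max n \<sigma>" "\<tau> = \<sigma> \<circ> cyc S (Suc n)" by auto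
  moreover have "\<sigma> permutes {1..Suc n}" using calculation(1) permutes_subset by fastforce
  moreover have "S \<subseteq> {1..n}" using calculation(2) lr_max_sub by blast
  ultimately show "\<tau> \<in> {\<tau>. \<tau> permutes {1..Suc n}}" using permutes_compose[OF cyc_permutes] by simp
next
  fix \<tau> assume "\<tau> \<in> {\<tau>. \<tau> permutes {1..Suc n}}"
  then obtain \<sigma> S where "\<sigma> permutes {1..n}" "S \<subseteq> lr_max n \<sigma>" "\<tau> = \<sigma> \<circ> cyc S (Suc n)"
    using lr_max_cyc_surj[of \<tau> n] by (metis (no_types, lifting) mem_Collect_eq)
  then show "\<tau> \<in> (\<lambda>(\<sigma>, S). \<sigma> \<circ> cyc S (Suc n)) ` (SIGMA \<sigma>:{\<sigma>. \<sigma> permutes {1..n}}. Pow (lr_max n \<sigma>))"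
    by (intro image_eqI[of _ _ "(\<sigma>, S)"]) auto
qed

section \<open>The permutation of a tableau\<close>

text \<open>As rewrite rules the equations of \<open>exit_step\<close> would unfold without end.\<close>

declare exit_step.simps [simp del]

text \<open>
  The letter of \<open>Phi T\<close> as a function of its place, extended by the identity so that permutations
  of different sizes can be composed.
\<close>

definition phi :: "tableau \<Rightarrow> nat \<Rightarrow> nat" where
  "phi T l = (if l \<in> {1..tableau_size T} then Phi T ! (l - 1) else l)"

lemma covered_size: "T \<in> covered n \<Longrightarrow> tableau_size T = n"
  by (simp add: covered_def)

lemma phi_label:
  assumes "T \<in> covered n" "s \<in> set (border T)"
  shows "phi T (label T s) = label T (entry_exit T s)"
  using border_covered[OF assms(1)] label_nth[OF assms(2)] covered_size[OF assms(1)]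
  by (auto simp: phi_def Phi_def)

lemma exit_step_in_border:
  "T \<in> covered n \<Longrightarrow> (d = Rightwards \<longrightarrow> i < length T) \<Longrightarrow> (d = Downwards \<longrightarrow> j < num_cols T) \<Longrightarrow>
    exit_step T d i j \<in> set (border T)"
proof (induction T d i j rule: exit_step.induct)
  case (1 T i j)
  have "in_diagram T i j \<Longrightarrow> j < num_cols T" using 1(3) in_diagram_num_cols by (simp add: covered_def)
  then show ?case using 1 border_covered[OF 1(3)]
    by (simp add: exit_step.simps(1)[of T i j])
next
  case (2 T i j)
  have "in_diagram T i j \<Longrightarrow> i < length T" by (simp add: in_diagram_def)
  then show ?case using 2 border_covered[OF 2(3)]
    by (simp add: exit_step.simps(2)[of T i j])
qed

lemma entry_exit_in_border:
  assumes "T \<in> covered n" "s \<in> set (border T)"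
  shows "entry_exit T s \<in> set (border T)"
  using border_covered[OF assms(1)] assms exit_step_in_border[OF assms(1)] by (cases s) auto

lemma exit_step_extend_empty: "exit_step (extend T {}) d i j = exit_step T d i j"
proof (induction T d i j rule: exit_step.induct)
  case (1 T i j)
  then show ?case
    by (simp add: exit_step.simps(1)[of "extend T {}" i j] exit_step.simps(1)[of T i j] extend_cells)
next
  case (2 T i j)
  then show ?case
    by (simp add: exit_step.simps(2)[of "extend T {}" i j] exit_step.simps(2)[of T i j] extend_cells)
qed

lemma exit_step_extend_Suc:
  assumes "S \<noteq> {}"
  shows "exit_step (extend T S) d i (Suc j) = shift_col (exit_step T d i j)"
  using assms
proof (induction T d i j rule: exit_step.induct)
  case (1 T i j)
  then show ?case
    by (simp add: exit_step.simps(1)[of "extend T S" i "Suc j"] exit_step.simps(1)[of T i j] extend_cells)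
next
  case (2 T i j)
  then show ?case
    by (simp add: exit_step.simps(2)[of "extend T S" i "Suc j"] exit_step.simps(2)[of T i j] extend_cells)
qed

lemma label_exit_shift:
  assumes "T \<in> covered n" "S \<noteq> {}" "S \<subseteq> row_labels T" "s \<in> set (border T)"
  shows "label (extend T S) (shift_col (entry_exit T s)) = phi T (label T s)"
  using label_extend(1)[OF assms(1-3) entry_exit_in_border[OF assms(1,4)]] phi_label[OF assms(1,4)] by simp

text \<open>
  In the new leftmost column, a path heading down falls to the next 1 and there enters, from the
  left, the old tableau in the row with label \<open>m\<close>. If there is no such 1, it leaves through the
  bottom, which is the case \<open>m = Suc n\<close>, where \<open>phi T m = m\<close>.
\<close>

lemma exit_down_new_col:
  assumes T: "T \<in> covered n" and S: "S \<noteq> {}" "S \<subseteq> row_labels T"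
  shows "i \<le> length T \<Longrightarrow> m \<in> insert (Suc n) S \<Longrightarrow> (\<forall>i'<i. label T (Vert i') < m) \<Longrightarrow>
    (\<forall>i'. i \<le> i' \<longrightarrow> i' < length T \<longrightarrow> label T (Vert i') \<in> S \<longrightarrow> m \<le> label T (Vert i')) \<Longrightarrow>
    label (extend T S) (exit_step (extend T S) Downwards i 0) = phi T m"
proof (induction "length T - i" arbitrary: i)
  case 0
  then have i: "i = length T" by simp
  then have "m = Suc n" using 0 S(2) by (auto simp: row_labels_def)
  moreover have "exit_step (extend T S) Downwards i 0 = Horiz 0"
    using i S(1) by (subst exit_step.simps) (simp add: in_diagram_extend_0)
  ultimately show ?case using label_extend(2)[OF T S] covered_size[OF T] by (simp add: phi_def)
next
  case (Suc x)
  then have i: "i < length T" by simp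
  show ?case
  proof (cases "label T (Vert i) \<in> S")
    case True
    have le: "m \<le> label T (Vert i)" using Suc.prems(4) i True by blast
    moreover have "label T (Vert i) \<le> n" using label_range(1)[OF T i] by simp
    ultimately have "m \<in> S" using Suc.prems(2) by auto
    then obtain i' where i': "i' < length T" "m = label T (Vert i')" using S(2) by (auto simp: row_labels_def)
    have "\<not> i' < i" using Suc.prems(3) i' by auto
    moreover have "\<not> i < i'" using label_order(1)[OF T, of i i'] le i' by auto
    ultimately have m: "m = label T (Vert i)" using i' by simp
    have "exit_step (extend T S) Downwards i 0 = exit_step (extend T S) Rightwards i (Suc 0)"
      using i True S(1) by (simp add: exit_step.simps(2)[of _ i 0] extend_cells)
    also have "\<dots> = shift_col (entry_exit T (Vert i))" by (simp add: exit_step_extend_Suc[OF S(1)])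
    finally show ?thesis using label_exit_shift[OF T S Vert_in_border[OF i]] m by simp
  next
    case False
    have e: "exit_step (extend T S) Downwards i 0 = exit_step (extend T S) Downwards (Suc i) 0"
      using i False S(1) by (simp add: exit_step.simps(2)[of _ i 0] extend_cells)
    have "label T (Vert i) < m"
    proof (cases "m = Suc n")
      case True
      then show ?thesis using label_range(1)[OF T i] by simp
    next
      case nN: False
      then have "m \<in> S" using Suc.prems(2) by simp
      then obtain i' where i': "i' < length T" "m = label T (Vert i')" using S(2) by (auto simp: row_labels_def)
      have "\<not> i' < i" using Suc.prems(3) i' by auto
      moreover have "i \<noteq> i'" using False \<open>m \<in> S\<close> i' by auto
      ultimately show ?thesis using label_order(1)[OF T, of i i'] i' by simp
    qed
    then show ?thesis unfolding e using Suc.prems(2-4) Suc.hyps i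
      by (intro Suc.hyps(1)) (auto simp: less_Suc_eq)
  qed
qed

text \<open>
  A path that enters in a row with a 1 in the new column continues as the old path of the next such
  row below; from the last such row it drops out at the new label, and the path entering at the
  new label continues as the old path of the topmost such row. All other paths are unchanged.
\<close>

lemma phi_extend:
  assumes T: "T \<in> covered n" and S: "S \<subseteq> row_labels T"
  shows "phi (extend T S) = phi T \<circ> cyc S (Suc n)"
proof
  fix k
  let ?T = "extend T S"
  have cT: "?T \<in> covered (Suc n)" using extend_covered[OF T S] .
  have Sn: "S \<subseteq> {1..n}" using S row_labels_sub[OF T] by blast
  note b = border_covered[OF T]
  show "phi ?T k = (phi T \<circ> cyc S (Suc n)) k"
  proof (cases "k \<in> {1..Suc n}")
    case False
    then have "phi ?T k = k" "phi T k = k" using covered_size[OF T] covered_size[OF cT] by (auto simp: phi_def)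
    moreover have "cyc S (Suc n) k = k" using False Sn by (intro cyc_out) auto
    ultimately show ?thesis by simp
  next
    case True
    then obtain s where s: "s \<in> set (border ?T)" "k = label ?T s"
      using label_bij[OF cT] by (metis bij_betw_def image_iff)
    have pk: "phi ?T k = label ?T (entry_exit ?T s)" using phi_label[OF cT s(1)] s(2) by simp
    show ?thesis
    proof (cases "S = {}")
      case True
      have e: "entry_exit ?T s = entry_exit T s"
        using True exit_step_extend_empty[of T] by (cases s) simp_all
      show ?thesis
      proof (cases "s \<in> set (border T)")
        case sT: True
        have "phi ?T k = label T (entry_exit T s)"
          using label_extend_empty(1)[OF T entry_exit_in_border[OF T sT]] pk e True by simp
        also have "\<dots> = phi T k" using phi_label[OF T sT] label_extend_empty(1)[OF T sT] s True by simp
        finally show ?thesis using True by (simp add: cyc_empty)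
      next
        case False
        then have sv: "s = Vert (length T)" using s True by (auto simp: border_extend_empty)
        then have "k = Suc n" using s True label_extend_empty(2)[OF T] by simp
        moreover have "entry_exit T s = s" using sv by (simp add: exit_step.simps(1)[of T] in_diagram_def)
        ultimately show ?thesis using pk e s True covered_size[OF T] by (simp add: cyc_empty phi_def)
      qed
    next
      case False
      note SS = False S
      consider (old) s' where "s' \<in> set (border T)" "s = shift_col s'" | (new) "s = Horiz 0"
        using s(1) by (auto simp: border_extend[OF SS])
      then show ?thesis
      proof cases
        case new
        then have k: "k = Suc n" using s label_extend(2)[OF T SS] by simp
        have "phi ?T k = phi T (cyc S (Suc n) (Suc n))"
          using exit_down_new_col[OF T SS, of 0, OF _ cyc_last(1)[OF Sn]] cyc_last(2)[OF Sn] pk new by simp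
        then show ?thesis using k by simp
      next
        case old
        then have k: "k = label T s'" using s label_extend(1)[OF T SS] by simp
        have k': "k \<in> {1..n}" using label_bij[OF T] old(1) k by (auto simp: bij_betw_def)
        show ?thesis
        proof (cases "\<exists>i. s' = Vert i \<and> k \<in> S")
          case True
          then obtain i where i: "s' = Vert i" "k \<in> S" by blast
          have il: "i < length T" using old(1) b i by auto
          note nx = cyc_next[OF Sn i(2)]
          have "entry_exit ?T s = exit_step ?T Downwards (Suc i) 0"
            using i old k il False by (simp add: exit_step.simps(1)[of _ i 0] extend_cells)
          moreover have "label ?T (exit_step ?T Downwards (Suc i) 0) = phi T (cyc S (Suc n) k)"
          proof (rule exit_down_new_col[OF T SS _ nx(1)])
            show "Suc i \<le> length T" using il by simp
            show "\<forall>i'<Suc i. label T (Vert i') < cyc S (Suc n) k"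
            proof (intro allI impI)
              fix i' assume "i' < Suc i"
              then have "label T (Vert i') \<le> k" using label_order(1)[OF T, of i' i] il k i by (auto simp: less_Suc_eq)
              then show "label T (Vert i') < cyc S (Suc n) k" using nx(2) by simp
            qed
            show "\<forall>i'. Suc i \<le> i' \<longrightarrow> i' < length T \<longrightarrow> label T (Vert i') \<in> S \<longrightarrow> cyc S (Suc n) k \<le> label T (Vert i')"
              using nx(3) label_order(1)[OF T, of i] k i by (auto simp: Suc_le_eq)
          qed
          ultimately show ?thesis using pk by simp
        next
          case nS: False
          have kS: "k \<notin> S"
          proof
            assume "k \<in> S"
            then obtain i where i: "i < length T" "k = label T (Vert i)" using S by (auto simp: row_labels_def)
            then have "s' = Vert i" using label_inj[OF old(1) Vert_in_border[OF i(1)]] k by simp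
            then show False using nS \<open>k \<in> S\<close> by blast
          qed
          have "entry_exit ?T s = shift_col (entry_exit T s')"
          proof (cases s')
            case (Vert i)
            then show ?thesis using old(2) kS k False exit_step_extend_Suc[OF False, of T Rightwards i 0] old(1) b
              by (auto simp: exit_step.simps(1)[of "extend T S" i 0] extend_cells)
          next
            case (Horiz j)
            then show ?thesis using old(2) exit_step_extend_Suc[OF False] by (simp)
          qed
          then have "phi ?T k = phi T k" using pk label_exit_shift[OF T SS old(1)] k by simp
          then show ?thesis using kS k' by (simp add: cyc_out)
        qed
      qed
    qed
  qed
qed

lemma phi_permutes: "T \<in> covered n \<Longrightarrow> phi T permutes {1..n}"
proof (induction n arbitrary: T)
  case 0
  then have "phi T = id" by (auto simp: phi_def covered_def)
  then show ?case by (metis permutes_id)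
next
  case (Suc n)
  obtain T' S where T': "T' \<in> covered n" "S \<subseteq> row_labels T'" "T = extend T' S"
    using covered_SucE[OF Suc.prems] by blast
  have "S \<subseteq> {1..n}" using T' row_labels_sub by blast
  moreover have "phi T' permutes {1..Suc n}" using Suc.IH[OF T'(1)] permutes_subset by fastforce
  ultimately show ?case unfolding T'(3) phi_extend[OF T'(1,2)] by (intro permutes_compose cyc_permutes)
qed

text \<open>
  The cycle moves the row labels in \<open>S\<close> up to row labels or to the new label, so they remain weak
  excedances. The new label is fixed if it belongs to a row; otherwise it is sent to an old label.
\<close>

lemma row_labels_weak_excedances: "T \<in> covered n \<Longrightarrow> row_labels T = {l \<in> {1..n}. l \<le> phi T l}"
proof (induction n arbitrary: T)
  case 0
  then show ?case by (simp add: covered_0 row_labels_def)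
next
  case (Suc n)
  obtain T' S where T': "T' \<in> covered n" "S \<subseteq> row_labels T'" "T = extend T' S"
    using covered_SucE[OF Suc.prems] by blast
  note IH = Suc.IH[OF T'(1)]
  have Sn: "S \<subseteq> {1..n}" using T' row_labels_sub by blast
  have N: "phi T' (Suc n) = Suc n" using covered_size[OF T'(1)] by (simp add: phi_def)
  have p: "phi T k = phi T' (cyc S (Suc n) k)" for k using phi_extend[OF T'(1,2)] T'(3) by simp
  have w: "k \<le> phi T k \<longleftrightarrow> k \<in> row_labels T'" if k: "k \<in> {1..n}" for k
  proof (cases "k \<in> S")
    case True
    note nx = cyc_next[OF Sn True]
    have "cyc S (Suc n) k \<le> phi T' (cyc S (Suc n) k)"
      using nx(1) N T'(2) IH by auto
    then show ?thesis using True T'(2) nx(2) p by auto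
  next
    case False
    then show ?thesis using p k IH by (auto simp: cyc_out)
  qed
  have wN: "Suc n \<le> phi T (Suc n) \<longleftrightarrow> S = {}"
  proof (cases "S = {}")
    case True
    then show ?thesis using p N by (simp add: cyc_empty)
  next
    case False
    then obtain x where x: "x \<in> S" by blast
    have "cyc S (Suc n) (Suc n) \<in> {1..n}" using cyc_last[OF Sn] x Sn by fastforce
    then have "phi T (Suc n) \<in> {1..n}" using p permutes_in_image[OF phi_permutes[OF T'(1)]] by simp
    then show ?thesis using False by auto
  qed
  have "{l \<in> {1..Suc n}. l \<le> phi T l} = row_labels T' \<union> (if S = {} then {Suc n} else {})"
    using w wN row_labels_sub[OF T'(1)] by (auto simp: le_Suc_eq)
  then show ?case using row_labels_extend[OF T'(1,2)] T'(3) by auto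
qed

lemma shape_extend: "shape (extend T S) = (if S = {} then shape T @ [0] else map Suc (shape T))"
  by (auto simp: shape_def extend_def intro!: nth_equalityI)

text \<open>
  The row labels say which border steps are vertical.
\<close>

lemma shape_from_row_labels:
  "T \<in> covered n \<Longrightarrow> T' \<in> covered n \<Longrightarrow> row_labels T = row_labels T' \<Longrightarrow> shape T = shape T'"
proof (induction n arbitrary: T T')
  case 0
  then show ?case by (simp add: covered_0)
next
  case (Suc n)
  obtain U S where U: "U \<in> covered n" "S \<subseteq> row_labels U" "T = extend U S"
    using covered_SucE[OF Suc.prems(1)] by blast
  obtain U' S' where U': "U' \<in> covered n" "S' \<subseteq> row_labels U'" "T' = extend U' S'"
    using covered_SucE[OF Suc.prems(2)] by blast
  have n: "Suc n \<notin> row_labels U" "Suc n \<notin> row_labels U'" using row_labels_sub U(1) U'(1) by fastforce+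
  have r: "(if S = {} then insert (Suc n) (row_labels U) else row_labels U)
      = (if S' = {} then insert (Suc n) (row_labels U') else row_labels U')"
    using Suc.prems(3) row_labels_extend[OF U(1,2)] row_labels_extend[OF U'(1,2)] U(3) U'(3) by simp
  have S: "S = {} \<longleftrightarrow> S' = {}" using r n by (auto split: if_splits)
  moreover have "row_labels U = row_labels U'"
    using r n S insert_ident[OF n] by (cases "S = {}") simp_all
  ultimately show ?case using Suc.IH[OF U(1) U'(1)] U(3) U'(3) by (simp add: shape_extend)
qed

text \<open>
  A row without a 0 that has a 1 above it. Only such a row may receive a 1 in a new leftmost
  column of a Le-tableau.
\<close>

definition unrestricted :: "tableau \<Rightarrow> nat \<Rightarrow> bool" where
  "unrestricted T i \<longleftrightarrow> (\<forall>i' j. in_diagram T i j \<longrightarrow> i' < i \<longrightarrow> has_one T i' j \<longrightarrow> has_one T i j)"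

definition free_rows :: "tableau \<Rightarrow> nat set" where
  "free_rows T = {label T (Vert i) | i. i < length T \<and> unrestricted T i}"

lemma label_Vert_extend:
  assumes "T \<in> covered n" "S \<subseteq> row_labels T" "i < length T"
  shows "label (extend T S) (Vert i) = label T (Vert i)"
  using label_extend_empty(1)[OF assms(1) Vert_in_border[OF assms(3)]]
    label_extend(1)[OF assms(1) _ assms(2) Vert_in_border[OF assms(3)]] by (cases "S = {}") auto

lemma Le_extend:
  assumes T: "T \<in> covered n" and S: "S \<subseteq> row_labels T"
  shows "Le_tableau (extend T S) \<longleftrightarrow> Le_tableau T \<and> S \<subseteq> free_rows T"
proof -
  have c: "ferrers T" "every_col_has_one T" "ferrers (extend T S)" "every_col_has_one (extend T S)"
    using T extend_covered[OF T S] by (auto simp: covered_def)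
  show ?thesis
  proof (cases "S = {}")
    case True
    then show ?thesis using c by (simp add: Le_tableau_def extend_cells)
  next
    case False
    have sub: "S \<subseteq> free_rows T \<longleftrightarrow> (\<forall>i<length T. label T (Vert i) \<in> S \<longrightarrow> unrestricted T i)"
    proof
      assume "S \<subseteq> free_rows T"
      then show "\<forall>i<length T. label T (Vert i) \<in> S \<longrightarrow> unrestricted T i"
        using label_Vert_eq[of _ T] unfolding free_rows_def by blast
    next
      assume r: "\<forall>i<length T. label T (Vert i) \<in> S \<longrightarrow> unrestricted T i"
      show "S \<subseteq> free_rows T" using S r by (auto simp: free_rows_def row_labels_def)
    qed
    have "Le_tableau (extend T S) \<longleftrightarrow> Le_tableau T \<and> (\<forall>i<length T. label T (Vert i) \<in> S \<longrightarrow> unrestricted T i)"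
    proof (intro iffI conjI)
      assume L: "Le_tableau (extend T S)"
      then have L': "has_one (extend T S) i j"
        if "in_diagram (extend T S) i j" "i' < i" "j' < j" "has_one (extend T S) i' j" "has_one (extend T S) i j'"
        for i i' j j' using that unfolding Le_tableau_def by blast
      have "has_one T i j"
        if "in_diagram T i j" "i' < i" "j' < j" "has_one T i' j" "has_one T i j'" for i i' j j'
        using L'[of i "Suc j" i' "Suc j'"] that False by (simp add: extend_cells)
      then show "Le_tableau T" unfolding Le_tableau_def using c(1,2) by blast
      have "has_one T i j" if "i < length T" "label T (Vert i) \<in> S" "in_diagram T i j" "i' < i" "has_one T i' j" for i i' j
        using L'[of i "Suc j" i' 0] that False by (simp add: extend_cells)
      then show "\<forall>i<length T. label T (Vert i) \<in> S \<longrightarrow> unrestricted T i" unfolding unrestricted_def by blast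
    next
      assume R: "Le_tableau T \<and> (\<forall>i<length T. label T (Vert i) \<in> S \<longrightarrow> unrestricted T i)"
      have "has_one (extend T S) i j"
        if a: "in_diagram (extend T S) i j" "i' < i" "j' < j" "has_one (extend T S) i' j" "has_one (extend T S) i j'"
        for i i' j j'
      proof -
        obtain k where k: "j = Suc k" using a(3) by (cases j) auto
        have h: "in_diagram T i k" "has_one T i' k" using a k False by (auto simp: extend_cells)
        have "has_one T i k"
        proof (cases j')
          case 0
          then have "i < length T" "label T (Vert i) \<in> S" using a(5) False by (auto simp: extend_cells)
          then show ?thesis using R h a(2) unfolding unrestricted_def by blast
        next
          case (Suc k')
          then have "has_one T i k'" "k' < k" using a(3,5) k False by (auto simp: extend_cells)
          then show ?thesis using R h a(2) unfolding Le_tableau_def by blast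
        qed
        then show ?thesis using k False by (simp add: extend_cells)
      qed
      then show "Le_tableau (extend T S)" unfolding Le_tableau_def using c(3,4) by blast
    qed
    then show ?thesis using sub by simp
  qed
qed

lemma free_rows_sub: "free_rows T \<subseteq> row_labels T"
  by (auto simp: free_rows_def row_labels_def)

lemma unrestricted_extend:
  assumes "S \<noteq> {}" "i < length T"
  shows "unrestricted (extend T S) i \<longleftrightarrow>
    unrestricted T i \<and> ((\<exists>i'<i. label T (Vert i') \<in> S) \<longrightarrow> label T (Vert i) \<in> S)"
proof
  assume u: "unrestricted (extend T S) i"
  have "has_one T i j" if "in_diagram T i j" "i' < i" "has_one T i' j" for i' j
    using u[unfolded unrestricted_def, rule_format, of "Suc j" i'] that assms by (simp add: extend_cells)
  moreover have "label T (Vert i) \<in> S" if "i' < i" "label T (Vert i') \<in> S" for i'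
    using u[unfolded unrestricted_def, rule_format, of 0 i'] that assms by (simp add: extend_cells)
  ultimately show "unrestricted T i \<and> ((\<exists>i'<i. label T (Vert i') \<in> S) \<longrightarrow> label T (Vert i) \<in> S)"
    unfolding unrestricted_def by blast
next
  assume u: "unrestricted T i \<and> ((\<exists>i'<i. label T (Vert i') \<in> S) \<longrightarrow> label T (Vert i) \<in> S)"
  show "unrestricted (extend T S) i" unfolding unrestricted_def
  proof (intro allI impI)
    fix i' j assume "in_diagram (extend T S) i j" "i' < i" "has_one (extend T S) i' j"
    then show "has_one (extend T S) i j"
      using u assms unfolding unrestricted_def by (cases j) (auto simp: extend_cells)
  qed
qed

text \<open>
  A row below the topmost 1 of the new column stays unrestricted only if it has a 1 there itself.
  Left-to-right maxima change in the same way in \<open>lr_max_cyc\<close>.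
\<close>

lemma free_rows_extend:
  assumes T: "T \<in> covered n" and S: "S \<subseteq> free_rows T"
  shows "free_rows (extend T S) = (if S = {} then insert (Suc n) (free_rows T)
           else {r \<in> free_rows T. \<forall>s\<in>S. r < s} \<union> S)"
proof -
  have Sr: "S \<subseteq> row_labels T" using S free_rows_sub by blast
  note lab = label_Vert_extend[OF T Sr]
  show ?thesis
  proof (cases "S = {}")
    case True
    have u: "unrestricted (extend T {}) i = unrestricted T i" for i
      by (simp add: unrestricted_def extend_cells)
    have v: "unrestricted T (length T)" by (simp add: unrestricted_def in_diagram_def)
    have "free_rows (extend T {}) = insert (label (extend T {}) (Vert (length T)))
        {label (extend T {}) (Vert i) | i. i < length T \<and> unrestricted T i}"
      using v by (auto simp: free_rows_def length_extend u less_Suc_eq)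
    also have "\<dots> = insert (Suc n) (free_rows T)"
      using lab True label_extend_empty(2)[OF T] by (auto simp: free_rows_def) metis
    finally show ?thesis using True by simp
  next
    case False
    have len: "length (extend T S) = length T" using False by (simp add: length_extend)
    have "r \<in> free_rows (extend T S) \<longleftrightarrow> r \<in> {r \<in> free_rows T. \<forall>s\<in>S. r < s} \<union> S" for r
    proof
      assume "r \<in> free_rows (extend T S)"
      then obtain i where i: "i < length T" "r = label T (Vert i)" "unrestricted (extend T S) i"
        using lab by (auto simp: free_rows_def len)
      note u = i(3)[unfolded unrestricted_extend[OF False i(1)]]
      have rf: "r \<in> free_rows T" using i u by (auto simp: free_rows_def)
      show "r \<in> {r \<in> free_rows T. \<forall>s\<in>S. r < s} \<union> S"
      proof (cases "r \<in> S")
        case nS: False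
        have "r < s" if s: "s \<in> S" for s
        proof -
          obtain i' where i': "i' < length T" "s = label T (Vert i')" using s Sr by (auto simp: row_labels_def)
          have "\<not> i' < i" using u nS i(2) s i' by blast
          moreover have "i \<noteq> i'" using nS s i i' by auto
          ultimately show ?thesis using label_order(1)[OF T, of i i'] i i' by simp
        qed
        then show ?thesis using rf by simp
      qed simp
    next
      assume r: "r \<in> {r \<in> free_rows T. \<forall>s\<in>S. r < s} \<union> S"
      then obtain i where i: "i < length T" "r = label T (Vert i)" "unrestricted T i"
        using S by (auto simp: free_rows_def)
      have "r \<in> S" if "i' < i" "label T (Vert i') \<in> S" for i'
      proof -
        have "label T (Vert i') < r" using label_order(1)[OF T that(1) i(1)] i(2) by simp
        then show ?thesis using r that(2) by auto
      qed
      then have "unrestricted (extend T S) i"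
        unfolding unrestricted_extend[OF False i(1)] using i by blast
      then show "r \<in> free_rows (extend T S)" using i lab[OF i(1)]
        unfolding free_rows_def len by (metis (mono_tags, lifting) mem_Collect_eq)
    qed
    then show ?thesis using False by auto
  qed
qed

lemma Le_tableaux_covered: "Le_tableaux n = {T \<in> covered n. Le_tableau T}"
  by (auto simp: Le_tableaux_def covered_def Le_tableau_def)

lemma free_rows_lr_max: "T \<in> Le_tableaux n \<Longrightarrow> free_rows T = lr_max n (phi T)"
proof (induction n arbitrary: T)
  case 0
  then show ?case by (simp add: Le_tableaux_covered covered_0 free_rows_def lr_max_def)
next
  case (Suc n)
  have c: "T \<in> covered (Suc n)" "Le_tableau T" using Suc.prems by (auto simp: Le_tableaux_covered)
  obtain T' S where T': "T' \<in> covered n" "S \<subseteq> row_labels T'" "T = extend T' S"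
    using covered_SucE[OF c(1)] by blast
  have L: "Le_tableau T'" "S \<subseteq> free_rows T'" using Le_extend[OF T'(1,2)] c(2) T'(3) by auto
  have IH: "free_rows T' = lr_max n (phi T')" using Suc.IH T'(1) L(1) by (simp add: Le_tableaux_covered)
  show ?case unfolding T'(3) free_rows_extend[OF T'(1) L(2)] phi_extend[OF T'(1,2)] IH
    using lr_max_cyc(1)[OF phi_permutes[OF T'(1)] _ refl, of S] L(2) IH by metis
qed

lemma extend_inj:
  assumes T: "T \<in> covered n" "S \<subseteq> row_labels T" and T': "T' \<in> covered n" "S' \<subseteq> row_labels T'"
    and eq: "extend T S = extend T' S'"
  shows "T = T' \<and> S = S'"
proof -
  have "Suc n \<notin> row_labels T" "Suc n \<notin> row_labels T'" using row_labels_sub T(1) T'(1) by fastforce+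
  then have e: "S = {} \<longleftrightarrow> S' = {}"
    using row_labels_extend[OF T] row_labels_extend[OF T'] eq by (auto split: if_splits)
  show ?thesis
  proof (cases "S = {}")
    case True
    then show ?thesis using e eq by (simp add: extend_def)
  next
    case False
    have tl: "map tl (extend X Y) = X" if "Y \<noteq> {}" for X Y
      using that by (auto simp: extend_def intro: nth_equalityI)
    have TT: "T = T'" using tl False e eq by metis
    have "S = {label T (Vert i) | i. has_one (extend T S) i 0}"
      using T(2) False by (auto simp: extend_cells row_labels_def)
    moreover have "S' = {label T (Vert i) | i. has_one (extend T S) i 0}"
      using T'(2) False e eq TT by (auto simp: extend_cells row_labels_def)
    ultimately show ?thesis using TT by simp
  qed
qed

lemma Le_extend_bij:
  "bij_betw (\<lambda>(T, S). extend T S) (SIGMA T:Le_tableaux n. Pow (free_rows T)) (Le_tableaux (Suc n))"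
  unfolding bij_betw_def
proof (intro conjI equalityI subsetI)
  show "inj_on (\<lambda>(T, S). extend T S) (SIGMA T:Le_tableaux n. Pow (free_rows T))"
    by (rule inj_onI) (clarsimp simp: Le_tableaux_covered, meson extend_inj free_rows_sub order_trans)
next
  fix X assume "X \<in> (\<lambda>(T, S). extend T S) ` (SIGMA T:Le_tableaux n. Pow (free_rows T))"
  then obtain T S where X: "T \<in> Le_tableaux n" "S \<subseteq> free_rows T" "X = extend T S" by auto
  moreover have "S \<subseteq> row_labels T" using X(2) free_rows_sub by blast
  ultimately show "X \<in> Le_tableaux (Suc n)" using Le_extend extend_covered by (auto simp: Le_tableaux_covered)
next
  fix X assume "X \<in> Le_tableaux (Suc n)"
  then have c: "X \<in> covered (Suc n)" "Le_tableau X" by (auto simp: Le_tableaux_covered)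
  obtain T S where T: "T \<in> covered n" "S \<subseteq> row_labels T" "X = extend T S"
    using covered_SucE[OF c(1)] by blast
  then have "T \<in> Le_tableaux n" "S \<subseteq> free_rows T" using Le_extend[OF T(1,2)] c(2) by (auto simp: Le_tableaux_covered)
  then show "X \<in> (\<lambda>(T, S). extend T S) ` (SIGMA T:Le_tableaux n. Pow (free_rows T))"
    using T(3) by (intro image_eqI[of _ _ "(T, S)"]) auto
qed

text \<open>
  The recursions of \<open>Le_extend_bij\<close> and \<open>cyc_bij\<close> match by \<open>free_rows_lr_max\<close>.
\<close>

lemma phi_bij: "bij_betw phi (Le_tableaux n) {\<sigma>. \<sigma> permutes {1..n}}"
proof (induction n)
  case 0
  have "Le_tableaux 0 = {[]}"
    by (auto simp: Le_tableaux_covered covered_0 Le_tableau_def ferrers_def shape_def every_col_has_one_def num_cols_def in_diagram_def)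
  moreover have "phi [] = id" by (auto simp: phi_def tableau_size_def num_rows_def num_cols_def)
  ultimately show ?case by (simp add: bij_betw_def)
next
  case (Suc n)
  let ?A = "SIGMA T:Le_tableaux n. Pow (free_rows T)"
  let ?B = "SIGMA \<sigma>:{\<sigma>. \<sigma> permutes {1..n}}. Pow (lr_max n \<sigma>)"
  have "bij_betw (map_prod phi id) ?A ?B"
    unfolding bij_betw_def
  proof (intro conjI equalityI subsetI)
    show "inj_on (map_prod phi id) ?A"
      using Suc.IH by (auto simp: inj_on_def bij_betw_def)
  next
    fix x assume "x \<in> map_prod phi id ` ?A"
    then obtain T S where "T \<in> Le_tableaux n" "S \<subseteq> free_rows T" "x = (phi T, S)" by auto
    then show "x \<in> ?B" using free_rows_lr_max phi_permutes by (auto simp: Le_tableaux_covered)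
  next
    fix x assume "x \<in> ?B"
    then obtain \<sigma> S where x: "\<sigma> permutes {1..n}" "S \<subseteq> lr_max n \<sigma>" "x = (\<sigma>, S)" by auto
    then obtain T where "T \<in> Le_tableaux n" "\<sigma> = phi T" using Suc.IH by (auto simp: bij_betw_def)
    then show "x \<in> map_prod phi id ` ?A" using x free_rows_lr_max by (intro image_eqI[of _ _ "(T, S)"]) auto
  qed
  then have "bij_betw ((\<lambda>(\<sigma>, S). \<sigma> \<circ> cyc S (Suc n)) \<circ> map_prod phi id) ?A {\<tau>. \<tau> permutes {1..Suc n}}"
    using bij_betw_trans cyc_bij by blast
  moreover have "((\<lambda>(\<sigma>, S). \<sigma> \<circ> cyc S (Suc n)) \<circ> map_prod phi id) x = (phi \<circ> (\<lambda>(T, S). extend T S)) x"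
    if x: "x \<in> ?A" for x
  proof -
    obtain T S where TS: "x = (T, S)" "T \<in> covered n" "S \<subseteq> free_rows T"
      using x by (auto simp: Le_tableaux_covered)
    then show ?thesis using phi_extend[OF TS(2), of S] free_rows_sub[of T] by simp
  qed
  ultimately have "bij_betw (phi \<circ> (\<lambda>(T, S). extend T S)) ?A {\<tau>. \<tau> permutes {1..Suc n}}"
    using bij_betw_cong by (metis (no_types, lifting))
  then show ?case using bij_betw_comp_iff[OF Le_extend_bij] by blast
qed

definition perms :: "nat \<Rightarrow> nat list set" where
  "perms n = {w. distinct w \<and> set w = {1..n}}"

lemma perms_length: "w \<in> perms n \<Longrightarrow> length w = n"
  by (auto simp: perms_def dest: distinct_card)

lemma perms_words: "bij_betw (\<lambda>\<sigma>. map \<sigma> [1..<Suc n]) {\<sigma>. \<sigma> permutes {1..n}} (perms n)"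
  unfolding bij_betw_def
proof (intro conjI equalityI subsetI)
  show "inj_on (\<lambda>\<sigma>. map \<sigma> [1..<Suc n]) {\<sigma>. \<sigma> permutes {1..n}}"
  proof (rule inj_onI, clarify, rule ext)
    fix \<sigma> \<sigma>' k assume s: "\<sigma> permutes {1..n}" "\<sigma>' permutes {1..n}" "map \<sigma> [1..<Suc n] = map \<sigma>' [1..<Suc n]"
    show "\<sigma> k = \<sigma>' k"
    proof (cases "k \<in> {1..n}")
      case True
      then have "k \<in> set [1..<Suc n]" by auto
      then show ?thesis using s(3) unfolding map_eq_conv by blast
    next
      case False
      then show ?thesis using permutes_not_in s(1,2) by metis
    qed
  qed
next
  fix w assume "w \<in> (\<lambda>\<sigma>. map \<sigma> [1..<Suc n]) ` {\<sigma>. \<sigma> permutes {1..n}}"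
  then obtain \<sigma> where s: "\<sigma> permutes {1..n}" "w = map \<sigma> [1..<Suc n]" by auto
  have "inj_on \<sigma> A" for A using permutes_inj[OF s(1)] inj_on_subset by blast
  moreover have "set [1..<Suc n] = {1..n}" by auto
  ultimately show "w \<in> perms n"
    using permutes_image[OF s(1)] s(2) by (simp add: perms_def distinct_map del: upt_Suc)
next
  fix w assume w: "w \<in> perms n"
  define \<sigma> where "\<sigma> k = (if k \<in> {1..n} then w ! (k - 1) else k)" for k
  have l: "length w = n" using perms_length[OF w] .
  have "w = map \<sigma> [1..<Suc n]" using l by (intro nth_equalityI) (auto simp: \<sigma>_def simp del: upt_Suc)
  moreover have "\<sigma> permutes {1..n}"
  proof (rule bij_imp_permutes)
    have "inj_on \<sigma> {1..n}"
    proof (rule inj_onI)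
      fix x y assume a: "x \<in> {1..n}" "y \<in> {1..n}" "\<sigma> x = \<sigma> y"
      then have "x - 1 = y - 1" using w l by (auto simp: \<sigma>_def perms_def nth_eq_iff_index_eq)
      then show "x = y" using a by auto
    qed
    moreover have "\<sigma> ` {1..n} \<subseteq> {1..n}"
    proof
      fix y assume "y \<in> \<sigma> ` {1..n}"
      then obtain x where x: "x \<in> {1..n}" "y = w ! (x - 1)" by (auto simp: \<sigma>_def)
      then have "y \<in> set w" using l by auto
      then show "y \<in> {1..n}" using w by (simp add: perms_def)
    qed
    ultimately show "bij_betw \<sigma> {1..n} {1..n}" using endo_inj_surj by (metis bij_betw_def finite_atLeastAtMost)
    show "\<sigma> x = x" if "x \<notin> {1..n}" for x using that by (auto simp: \<sigma>_def)
  qed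
  ultimately show "w \<in> (\<lambda>\<sigma>. map \<sigma> [1..<Suc n]) ` {\<sigma>. \<sigma> permutes {1..n}}" by blast
qed

lemma Phi_phi: "T \<in> covered n \<Longrightarrow> Phi T = map (phi T) [1..<Suc n]"
  using border_covered[of T n] covered_size[of T n]
  by (intro nth_equalityI) (auto simp: phi_def Phi_def simp del: upt_Suc)

lemma Phi_bij: "bij_betw Phi (Le_tableaux n) (perms n)"
proof -
  have "bij_betw ((\<lambda>\<sigma>. map \<sigma> [1..<Suc n]) \<circ> phi) (Le_tableaux n) (perms n)"
    using bij_betw_trans[OF phi_bij perms_words] .
  moreover have "((\<lambda>\<sigma>. map \<sigma> [1..<Suc n]) \<circ> phi) T = Phi T" if "T \<in> Le_tableaux n" for T
    using that Phi_phi[of T n] by (simp add: Le_tableaux_covered del: upt_Suc)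
  ultimately show ?thesis using bij_betw_cong by (metis (no_types, lifting))
qed

lemma row_labels_Phi:
  assumes "T \<in> covered n"
  shows "row_labels T = {m \<in> {1..n}. m \<le> Phi T ! (m - 1)}"
  unfolding row_labels_weak_excedances[OF assms] using covered_size[OF assms] by (auto simp: phi_def)

section \<open>DE and the cyclic shift\<close>

lemma letter_Suc: "letter w (Suc i) = w ! i"
  by (simp add: letter_def)

lemma letter_0: "letter w 0 = 0"
  by (simp add: letter_def)

lemma letter_nth: "1 \<le> i \<Longrightarrow> letter w i = w ! (i - 1)"
  by (cases i) (simp_all add: letter_def)

lemma letter_bij:
  assumes "w \<in> perms n"
  shows "bij_betw (letter w) {1..n} {1..n}"
proof -
  have "bij_betw (\<lambda>i. w ! i) {..<n} {1..n}"
    using assms perms_length[OF assms] bij_betw_nth[of w "{..<n}" "{1..n}"] by (auto simp: perms_def)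
  moreover have "bij_betw (\<lambda>i. i - 1) {1..n} {..<n}"
    by (rule bij_betw_byWitness[where f' = Suc]) auto
  ultimately have "bij_betw ((\<lambda>i. w ! i) \<circ> (\<lambda>i. i - 1)) {1..n} {1..n}" by (rule bij_betw_trans[rotated])
  moreover have "((\<lambda>i. w ! i) \<circ> (\<lambda>i. i - 1)) i = letter w i" if "i \<in> {1..n}" for i
    using that by (simp add: letter_nth)
  ultimately show ?thesis using bij_betw_cong by (metis (no_types, lifting))
qed

lemma letter_range: "w \<in> perms n \<Longrightarrow> 1 \<le> i \<Longrightarrow> i \<le> n \<Longrightarrow> 1 \<le> letter w i \<and> letter w i \<le> n"
  using letter_bij[of w n] by (fastforce simp: bij_betw_def)

lemma letter_inj:
  assumes "w \<in> perms n" "i \<le> n" "j \<le> n" "letter w i = letter w j"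
  shows "i = j"
proof (cases "i = 0 \<or> j = 0")
  case True
  moreover have "letter w k \<noteq> 0" if "k \<noteq> 0" "k \<le> n" for k
    using letter_range[OF assms(1), of k] that by simp
  ultimately show ?thesis using assms(2-4) by (metis letter_0)
next
  case False
  then have "i \<in> {1..n}" "j \<in> {1..n}" using assms(2,3) by auto
  then show ?thesis using letter_bij[OF assms(1)] assms(4) inj_onD unfolding bij_betw_def by metis
qed

lemma letter_surj: "w \<in> perms n \<Longrightarrow> v \<in> {1..n} \<Longrightarrow> \<exists>i\<in>{1..n}. letter w i = v"
  using letter_bij[of w n] unfolding bij_betw_def by (metis image_iff)

lemma permsI: "bij_betw (letter w) {1..n} {1..n} \<Longrightarrow> length w = n \<Longrightarrow> w \<in> perms n"
proof -
  assume b: "bij_betw (letter w) {1..n} {1..n}" and l: "length w = n"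
  have "distinct w"
  proof (subst distinct_conv_nth, intro allI impI)
    fix i j assume "i < length w" "j < length w" "i \<noteq> j"
    then show "w ! i \<noteq> w ! j"
      using b l inj_onD[of "letter w" "{1..n}" "Suc i" "Suc j"] by (auto simp: bij_betw_def letter_Suc)
  qed
  moreover have "set w = letter w ` {1..n}"
  proof (intro equalityI subsetI)
    fix x assume "x \<in> set w"
    then obtain i where "i < n" "x = w ! i" using l by (auto simp: in_set_conv_nth)
    then show "x \<in> letter w ` {1..n}" by (intro image_eqI[of _ _ "Suc i"]) (auto simp: letter_Suc)
  next
    fix x assume "x \<in> letter w ` {1..n}"
    then show "x \<in> set w" using l by (auto simp: letter_nth)
  qed
  ultimately show ?thesis using b by (simp add: perms_def bij_betw_def)
qed

text \<open>
  The letters \<open>a\<^sub>i\<close> that fall under the second case in the definition of \<open>DE\<close>.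
\<close>

definition suffix_min :: "nat list \<Rightarrow> nat \<Rightarrow> bool" where
  "suffix_min w i \<longleftrightarrow> (\<forall>j\<in>{i<..length w}. letter w i \<le> letter w j)"

definition prev_smaller :: "nat list \<Rightarrow> nat \<Rightarrow> nat" where
  "prev_smaller w i = Max {k \<in> {..<i}. letter w k < letter w i}"

text \<open>
  \<open>DE\<close> is a form of the fundamental transformation: the word is cut after each suffix minimum,
  and this is the successor in the cycle on the positions of a piece.
\<close>

definition DE_next :: "nat list \<Rightarrow> nat \<Rightarrow> nat" where
  "DE_next w i = (if suffix_min w i then Suc (prev_smaller w i) else Suc i)"

lemma DE_place_next: "DE_place w i = letter w (DE_next w i)"
  by (auto simp: DE_place_def DE_next_def suffix_min_def prev_smaller_def not_less)

lemma prev_smaller: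
  assumes "w \<in> perms n" "1 \<le> i" "i \<le> n"
  shows "prev_smaller w i < i" "letter w (prev_smaller w i) < letter w i"
    "prev_smaller w i < k \<Longrightarrow> k < i \<Longrightarrow> letter w i < letter w k"
proof -
  let ?A = "{k \<in> {..<i}. letter w k < letter w i}"
  have f: "finite ?A" by simp
  have "0 \<in> ?A" using letter_range[OF assms] assms(2) by (simp add: letter_0)
  then have "prev_smaller w i \<in> ?A" unfolding prev_smaller_def by (metis Max_in empty_iff f)
  then show "prev_smaller w i < i" "letter w (prev_smaller w i) < letter w i" by auto
  show "letter w i < letter w k" if k: "prev_smaller w i < k" "k < i"
  proof -
    have "k \<notin> ?A"
    proof
      assume "k \<in> ?A"
      then have "k \<le> prev_smaller w i" unfolding prev_smaller_def using Max_ge[OF f] by blast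
      then show False using k(1) by simp
    qed
    moreover have "letter w k \<noteq> letter w i" using letter_inj[OF assms(1), of k i] k assms by auto
    ultimately show ?thesis using k by auto
  qed
qed

lemma DE_next_range:
  assumes "w \<in> perms n" "1 \<le> i" "i \<le> n"
  shows "1 \<le> DE_next w i \<and> DE_next w i \<le> n"
  using prev_smaller(1)[OF assms] assms perms_length[OF assms(1)]
  by (auto simp: DE_next_def suffix_min_def)

text \<open>
  The letters between the two places are larger than the suffix minimum \<open>a\<^sub>i\<close>, and so are the later
  ones. Thus the previous smaller letter of a suffix minimum is the previous suffix minimum, and
  \<open>DE_next\<close> closes the cycle of a piece at its first place.
\<close>

lemma suffix_min_prev:
  assumes w: "w \<in> perms n" "1 \<le> i" "i \<le> n" and m: "suffix_min w i" and p: "1 \<le> prev_smaller w i"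
  shows "suffix_min w (prev_smaller w i)"
  unfolding suffix_min_def
proof
  let ?k = "prev_smaller w i"
  note ps = prev_smaller[OF w]
  fix j assume j: "j \<in> {?k<..length w}"
  consider "j < i" | "j = i" | "i < j" by linarith
  then show "letter w ?k \<le> letter w j"
  proof cases
    case 1 then show ?thesis using ps(2) ps(3)[of j] j by simp
  next
    case 2 then show ?thesis using ps(2) by simp
  next
    case 3
    then have "letter w i \<le> letter w j" using m j by (simp add: suffix_min_def)
    then show ?thesis using ps(2) by simp
  qed
qed

lemma DE_next_inj:
  assumes w: "w \<in> perms n"
  shows "inj_on (DE_next w) {1..n}"
proof -
  have ne: "DE_next w i \<noteq> DE_next w i'"
    if i: "1 \<le> i" "i \<le> n" "1 \<le> i'" "i' \<le> n" "suffix_min w i" "\<not> suffix_min w i'" for i i'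
    using suffix_min_prev[OF w i(1,2,5)] i by (auto simp: DE_next_def)
  have ne2: "DE_next w i \<noteq> DE_next w i'"
    if i: "1 \<le> i" "i < i'" "i' \<le> n" "suffix_min w i" "suffix_min w i'" for i i'
  proof -
    have "letter w i \<le> letter w i'" using i perms_length[OF w] by (auto simp: suffix_min_def)
    moreover have "letter w i \<noteq> letter w i'" using letter_inj[OF w, of i i'] i by auto
    ultimately have "\<not> prev_smaller w i' < i" using prev_smaller(3)[OF w _ i(3), of i] i by auto
    moreover have "prev_smaller w i < i" using prev_smaller(1)[OF w i(1)] i by simp
    ultimately show ?thesis using i by (simp add: DE_next_def)
  qed
  have "i = i'" if "i \<in> {1..n}" "i' \<in> {1..n}" "DE_next w i = DE_next w i'" for i i'
  proof (cases "suffix_min w i"; cases "suffix_min w i'")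
    assume "suffix_min w i" "suffix_min w i'"
    then show ?thesis using ne2[of i i'] ne2[of i' i] that by (cases i i' rule: linorder_cases) auto
  next
    assume "\<not> suffix_min w i" "\<not> suffix_min w i'"
    then show ?thesis using that(3) by (simp add: DE_next_def)
  next
    assume "suffix_min w i" "\<not> suffix_min w i'"
    then show ?thesis using ne[of i i'] that by auto
  next
    assume "\<not> suffix_min w i" "suffix_min w i'"
    then show ?thesis using ne[of i' i] that by auto
  qed
  then show ?thesis by (auto simp: inj_on_def)
qed

lemma DE_place_bij:
  assumes w: "w \<in> perms n"
  shows "bij_betw (DE_place w) {1..n} {1..n}"
proof -
  have "DE_next w ` {1..n} \<subseteq> {1..n}" using DE_next_range[OF w] by fastforce
  then have "bij_betw (DE_next w) {1..n} {1..n}"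
    using DE_next_inj[OF w] endo_inj_surj by (metis bij_betw_def finite_atLeastAtMost)
  then have "bij_betw (letter w \<circ> DE_next w) {1..n} {1..n}" using letter_bij[OF w] by (rule bij_betw_trans)
  moreover have "letter w \<circ> DE_next w = DE_place w" by (auto simp: DE_place_next)
  ultimately show ?thesis by simp
qed

lemma length_DE: "length (DE w) = length w"
  by (simp add: DE_def del: upt_Suc)

lemma DE_letter:
  assumes w: "w \<in> perms n" and i: "i \<in> {1..n}"
  shows "letter (DE w) (DE_place w i) = letter w i"
proof -
  have l: "length w = n" using perms_length[OF w] .
  have r: "DE_place w i \<in> {1..n}" using DE_place_bij[OF w] i by (auto simp: bij_betw_def)
  have inj: "inj_on (DE_place w) {1..n}" using DE_place_bij[OF w] by (simp add: bij_betw_def)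
  have "(THE i'. i' \<in> {1..length w} \<and> DE_place w i' = DE_place w i) = i"
    using i l inj_onD[OF inj] by (intro the_equality) auto
  moreover have "letter (DE w) (DE_place w i) =
      letter w (THE i'. i' \<in> {1..length w} \<and> DE_place w i' = DE_place w i)"
    using r l by (auto simp: letter_nth DE_def simp del: upt_Suc)
  ultimately show ?thesis by simp
qed

lemma DE_perms:
  assumes w: "w \<in> perms n"
  shows "DE w \<in> perms n"
proof (rule permsI)
  show "length (DE w) = n" using perms_length[OF w] by (simp add: length_DE)
  have "bij_betw (letter (DE w) \<circ> DE_place w) {1..n} {1..n}"
    using letter_bij[OF w] DE_letter[OF w] by (subst bij_betw_cong[of _ _ "letter w"]) auto
  then show "bij_betw (letter (DE w)) {1..n} {1..n}"
    using bij_betw_comp_iff[OF DE_place_bij[OF w]] by blast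
qed

text \<open>
  This recovers a word from its image letter by letter. Whether \<open>a\<^sub>m\<close> is a suffix minimum can be
  decided from \<open>a\<^sub>1, \<dots>, a\<^sub>m\<close>. If it is not, then \<open>a\<^sub>m\<close> stands in place \<open>a\<^bsub>m+1\<^esub>\<close>. If it is, or if
  \<open>m = 0\<close>, then a new piece begins, and the letter in place \<open>a\<^bsub>m+1\<^esub>\<close> is the last letter of that
  piece, the smallest one not yet used.
\<close>

lemma DE_after_prefix:
  assumes w: "w \<in> perms n" and m: "m < n"
  shows "letter (DE w) (letter w (Suc m)) =
    (if \<exists>v\<in>{1..<letter w m}. v \<notin> letter w ` {..m} then letter w m
     else (LEAST v. v \<in> {1..n} - letter w ` {..m}))"
proof (cases "\<exists>v\<in>{1..<letter w m}. v \<notin> letter w ` {..m}")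
  case True
  then obtain v where v: "v \<in> {1..<letter w m}" "v \<notin> letter w ` {..m}" by blast
  have m1: "1 \<le> m" using v by (cases m) (auto simp: letter_0)
  have "v \<in> {1..n}" using v letter_range[OF w m1] m by auto
  then obtain j where j: "j \<in> {1..n}" "letter w j = v" using letter_surj[OF w] by blast
  then have "m < j" using v(2) by (metis atMost_iff image_eqI not_less)
  then have "\<not> suffix_min w m" using j v(1) perms_length[OF w] by (force simp: suffix_min_def)
  then have pl: "DE_place w m = letter w (Suc m)" by (simp add: DE_place_next DE_next_def)
  have "m \<in> {1..n}" using m m1 by simp
  from DE_letter[OF w this] have "letter (DE w) (letter w (Suc m)) = letter w m"
    by (simp only: pl)
  from trans[OF this if_P[OF True, symmetric]] show ?thesis .
next
  case False
  define v where "v = (LEAST v. v \<in> {1..n} - letter w ` {..m})"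
  have fresh: "letter w k \<notin> letter w ` {..m}" if "m < k" "k \<le> n" for k
  proof
    assume "letter w k \<in> letter w ` {..m}"
    then obtain j where "j \<le> m" "letter w k = letter w j" by auto
    then show False using letter_inj[OF w, of k j] that m by simp
  qed
  have ex: "letter w (Suc m) \<in> {1..n} - letter w ` {..m}"
    using letter_range[OF w, of "Suc m"] fresh[of "Suc m"] m by simp
  have v: "v \<in> {1..n}" "v \<notin> letter w ` {..m}" using LeastI[of "\<lambda>v. v \<in> {1..n} - letter w ` {..m}", OF ex]
    unfolding v_def by auto
  obtain p where p: "p \<in> {1..n}" "letter w p = v" using letter_surj[OF w v(1)] by blast
  have mp: "m < p" using p v(2) by (metis atMost_iff image_eqI not_less)
  have least: "v \<le> letter w k" if "m < k" "k \<le> n" for k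
  proof -
    have "letter w k \<in> {1..n} - letter w ` {..m}"
      using fresh[OF that] letter_range[OF w, of k] that by simp
    then show ?thesis unfolding v_def by (rule Least_le)
  qed
  have min: "suffix_min w p" using least mp p perms_length[OF w] by (auto simp: suffix_min_def)
  have "letter w m < v"
  proof -
    have "v \<notin> {1..<letter w m}" using False v(2) by blast
    moreover have "v \<noteq> letter w m" using v(2) by auto
    ultimately show ?thesis using v(1) by auto
  qed
  then have mA: "m \<in> {k \<in> {..<p}. letter w k < letter w p}" using mp p(2) by simp
  have "prev_smaller w p = m" unfolding prev_smaller_def
  proof (rule Max_eqI)
    fix y assume y: "y \<in> {k \<in> {..<p}. letter w k < letter w p}"
    show "y \<le> m"
    proof (rule ccontr)
      assume "\<not> y \<le> m"
      then have "v \<le> letter w y" using least[of y] y p(1) by simp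
      then show False using y p(2) by simp
    qed
  qed (use mA in simp_all)
  then have pl: "DE_place w p = letter w (Suc m)" using min by (simp add: DE_place_next DE_next_def)
  from DE_letter[OF w p(1)] have "letter (DE w) (letter w (Suc m)) = v"
    by (simp only: pl p(2))
  from trans[OF this[unfolded v_def] if_not_P[OF False, symmetric]] show ?thesis .
qed

lemma DE_inj: "inj_on DE (perms n)"
proof (rule inj_onI)
  fix w w' assume w: "w \<in> perms n" "w' \<in> perms n" and eq: "DE w = DE w'"
  have "\<forall>i\<le>m. letter w i = letter w' i" if "m \<le> n" for m
    using that
  proof (induction m)
    case 0
    then show ?case by (simp add: letter_0)
  next
    case (Suc m)
    then have IH: "letter w i = letter w' i" if "i \<le> m" for i using that by simp
    have im: "letter w ` {..m} = letter w' ` {..m}" using IH by (intro image_cong) auto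
    have "letter (DE w) (letter w (Suc m)) = letter (DE w) (letter w' (Suc m))"
      using DE_after_prefix[OF w(1), of m] DE_after_prefix[OF w(2), of m] Suc.prems eq
      unfolding im IH[OF order.refl] by simp
    then have "letter w (Suc m) = letter w' (Suc m)"
      using letter_inj[OF DE_perms[OF w(1)]] letter_range w Suc.prems by (metis Suc_le_mono le0 One_nat_def)
    then show ?case using IH by (auto simp: le_Suc_eq)
  qed
  then have "w ! i = w' ! i" if "i < n" for i using that letter_Suc by (metis Suc_leI order.refl)
  then show "w = w'" using perms_length w by (metis nth_equalityI)
qed

lemma finite_perms: "finite (perms n)"
  using perms_words[of n] finite_permutations[of "{1..n}"] bij_betw_finite by blast

lemma DE_bij: "bij_betw DE (perms n) (perms n)"
  using DE_inj DE_perms endo_inj_surj[OF finite_perms _ DE_inj] by (metis bij_betw_def image_subsetI)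

lemma letter_down_shift:
  "1 \<le> m \<Longrightarrow> m \<le> length w \<Longrightarrow>
    letter (down_shift w) m = (if letter w m - 1 = 0 then length w else letter w m - 1)"
  by (auto simp: letter_nth down_shift_def)

lemma down_shift_bij: "bij_betw down_shift (perms n) (perms n)"
proof -
  have perm: "down_shift w \<in> perms n" if w: "w \<in> perms n" for w
  proof -
    have l: "length w = n" using perms_length[OF w] .
    let ?f = "\<lambda>a. if a - 1 = 0 then n else a - (1::nat)"
    have inj: "inj_on ?f {1..n}" by (auto simp: inj_on_def)
    have "?f ` {1..n} \<subseteq> {1..n}" by auto
    then have im: "?f ` {1..n} = {1..n}" using endo_inj_surj[OF _ _ inj] by blast
    have ds: "down_shift w = map ?f w" unfolding down_shift_def l by blast
    have dw: "distinct w" and sw: "set w = {1..n}" using w by (auto simp: perms_def)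
    have "distinct (map ?f w)" unfolding distinct_map sw using inj dw by blast
    moreover have "set (map ?f w) = {1..n}" unfolding set_map sw by (rule im)
    ultimately show ?thesis unfolding ds by (simp only: perms_def mem_Collect_eq)
  qed
  moreover have "inj_on down_shift (perms n)"
  proof (rule inj_onI)
    fix w w' assume w: "w \<in> perms n" "w' \<in> perms n" "down_shift w = down_shift w'"
    have l: "length w = n" "length w' = n" using perms_length w by auto
    have "w ! i = w' ! i" if "i < n" for i
    proof -
      have "w ! i \<in> {1..n}" "w' ! i \<in> {1..n}" using w l that nth_mem by (auto simp: perms_def)
      moreover have "down_shift w ! i = down_shift w' ! i" using w(3) by simp
      ultimately show ?thesis using that l by (auto simp: down_shift_def split: if_splits)
    qed
    then show "w = w'" using l by (intro nth_equalityI) auto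
  qed
  ultimately show ?thesis using endo_inj_surj[OF finite_perms] by (metis bij_betw_def image_subsetI)
qed

definition bottoms :: "nat list \<Rightarrow> nat set" where
  "bottoms w = {w ! k | k. k < length w \<and> (k = 0 \<or> w ! k < w ! (k - 1))}"

lemma letter_in_bottoms:
  assumes w: "w \<in> perms n" and k: "1 \<le> k" "k \<le> n"
  shows "letter w k \<in> bottoms w \<longleftrightarrow> k = 1 \<or> letter w k < letter w (k - 1)"
proof -
  have l: "length w = n" using perms_length[OF w] .
  obtain i where i: "k = Suc i" using k by (cases k) auto
  have "w ! i = w ! i' \<Longrightarrow> i' < n \<Longrightarrow> i = i'" for i'
    using w l k i by (auto simp: perms_def nth_eq_iff_index_eq)
  then have "w ! i \<in> bottoms w \<longleftrightarrow> i = 0 \<or> w ! i < w ! (i - 1)"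
    using l k i by (auto simp: bottoms_def)
  then show ?thesis using i by (cases i) (auto simp: letter_Suc)
qed

text \<open>
  In place \<open>a\<^bsub>i+1\<^esub>\<close> the letter \<open>a\<^sub>i\<close> is an excedance iff there is a descent. A suffix minimum
  \<open>a\<^sub>i\<close> goes to a place \<open>a\<^bsub>k+1\<^esub> \<ge> a\<^sub>i > a\<^sub>k\<close>, neither an excedance nor a descent bottom, unless
  \<open>k = 0\<close>; then \<open>a\<^sub>i = 1\<close> is in place \<open>a\<^sub>1\<close> and is shifted to \<open>n\<close>.
\<close>

lemma weak_excedances_bottoms:
  assumes w: "w \<in> perms n"
  shows "{m \<in> {1..n}. m \<le> letter (down_shift (DE w)) m} = bottoms w"
proof -
  have l: "length w = n" using perms_length[OF w] .
  have key: "m \<le> letter (down_shift (DE w)) m \<longleftrightarrow> m \<in> bottoms w" if m: "m \<in> {1..n}" for m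
  proof -
    obtain i where i: "i \<in> {1..n}" "DE_place w i = m"
      using DE_place_bij[OF w] m by (metis bij_betw_def image_iff)
    let ?a = "letter w i"
    have a: "1 \<le> ?a" "?a \<le> n" using letter_range[OF w, of i] i by auto
    have "letter (DE w) m = ?a" using DE_letter[OF w i(1)] i(2) by simp
    then have lhs: "m \<le> letter (down_shift (DE w)) m \<longleftrightarrow> ?a = 1 \<or> m < ?a"
      using letter_down_shift[of m "DE w"] m l a by (auto simp: length_DE)
    have mn: "m = letter w (DE_next w i)" using i(2) by (simp add: DE_place_next)
    have rng: "1 \<le> DE_next w i" "DE_next w i \<le> n" using DE_next_range[OF w, of i] i(1) by auto
    have rhs: "m \<in> bottoms w \<longleftrightarrow> DE_next w i = 1 \<or> letter w (DE_next w i) < letter w (DE_next w i - 1)"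
      using letter_in_bottoms[OF w rng] mn by simp
    show ?thesis
    proof (cases "suffix_min w i")
      case False
      then obtain j where "i < j" "j \<le> n" "letter w j < ?a" using l by (force simp: suffix_min_def)
      then have "?a \<noteq> 1" using letter_range[OF w, of j] i(1) by auto
      then show ?thesis unfolding lhs rhs using mn False i(1) by (simp add: DE_next_def)
    next
      case True
      have nx: "DE_next w i = Suc (prev_smaller w i)" using True by (simp add: DE_next_def)
      note ps = prev_smaller[OF w, of i]
      have i1: "1 \<le> i" "i \<le> n" using i(1) by auto
      show ?thesis
      proof (cases "prev_smaller w i = 0")
        case z: True
        obtain j where j: "j \<in> {1..n}" "letter w j = 1" using letter_surj[OF w, of 1] m by auto
        consider "j < i" | "j = i" | "i < j" by linarith
        then have "?a = 1"
        proof cases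
          case 1 then show ?thesis using ps(3)[OF i1, of j] z j a by simp
        next
          case 2 then show ?thesis using j by simp
        next
          case 3
          then have "j \<in> {i<..length w}" using j l by simp
          then have "?a \<le> letter w j" using True unfolding suffix_min_def by blast
          then show ?thesis using j a by simp
        qed
        then show ?thesis unfolding lhs rhs using nx z by simp
      next
        case nz: False
        have "?a \<le> letter w (Suc (prev_smaller w i))"
          using ps(1)[OF i1] ps(3)[OF i1, of "Suc (prev_smaller w i)"]
          by (cases "Suc (prev_smaller w i) = i") auto
        moreover have "1 \<le> letter w (prev_smaller w i)"
          using letter_range[OF w, of "prev_smaller w i"] nz ps(1)[OF i1] i1 by simp
        ultimately show ?thesis unfolding lhs rhs using nx nz ps(2)[OF i1] mn by auto
      qed
    qed
  qed
  moreover have "bottoms w \<subseteq> {1..n}" using w by (force simp: bottoms_def perms_def)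
  ultimately show ?thesis by blast
qed

section \<open>Descent bottoms and relative order determine a permutation\<close>

definition before :: "'a list \<Rightarrow> 'a \<Rightarrow> 'a \<Rightarrow> bool" where
  "before w x y \<longleftrightarrow> (\<exists>i j. i < j \<and> j < length w \<and> w ! i = x \<and> w ! j = y)"

lemma before_nth: "distinct w \<Longrightarrow> i < length w \<Longrightarrow> j < length w \<Longrightarrow> before w (w ! i) (w ! j) \<longleftrightarrow> i < j"
  by (auto simp: before_def nth_eq_iff_index_eq)

lemma nth_in_bottoms:
  "distinct w \<Longrightarrow> k < length w \<Longrightarrow> w ! k \<in> bottoms w \<longleftrightarrow> k = 0 \<or> w ! k < w ! (k - 1)"
  by (auto simp: bottoms_def nth_eq_iff_index_eq)

text \<open>
  The letters of a run of descent bottoms decrease, so the run that ends in place \<open>p\<close> cannot reach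
  back to the smaller letter in place \<open>m\<close>. It starts later, with a descent from a letter that is
  not a bottom and not in place \<open>m\<close> either.
\<close>

lemma top_before_bottom:
  assumes "distinct w"
  shows "p < length w \<Longrightarrow> w ! p \<in> bottoms w \<Longrightarrow> m < p \<Longrightarrow> w ! m < w ! p \<Longrightarrow>
    \<exists>i. m < i \<and> i < p \<and> w ! i \<notin> bottoms w \<and> w ! p < w ! i"
proof (induction p)
  case (Suc p)
  have d: "w ! Suc p < w ! p" using nth_in_bottoms[OF assms Suc.prems(1)] Suc.prems(2) by simp
  have mp: "m < p" using d Suc.prems by (cases "m = p") auto
  show ?case
  proof (cases "w ! p \<in> bottoms w")
    case True
    have "p < length w" "w ! m < w ! p" using Suc.prems(1,4) d by simp_all
    then obtain i where i: "m < i" "i < p" "w ! i \<notin> bottoms w" "w ! p < w ! i"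
      using Suc.IH True mp by blast
    then have "w ! Suc p < w ! i" "i < Suc p" using d by simp_all
    then show ?thesis using i by blast
  next
    case False
    then show ?thesis using mp d lessI by blast
  qed
qed simp

lemma bottom_before_top:
  assumes "distinct w"
  shows "p < length w \<Longrightarrow> w ! p \<notin> bottoms w \<Longrightarrow> m < p \<Longrightarrow> w ! p < w ! m \<Longrightarrow>
    \<exists>i. m < i \<and> i < p \<and> w ! i \<in> bottoms w \<and> w ! i < w ! p"
proof (induction p)
  case (Suc p)
  have "w ! p \<noteq> w ! Suc p" using assms Suc.prems(1) by (simp add: nth_eq_iff_index_eq)
  then have d: "w ! p < w ! Suc p" using nth_in_bottoms[OF assms Suc.prems(1)] Suc.prems(2) by simp
  have mp: "m < p" using d Suc.prems by (cases "m = p") auto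
  show ?case
  proof (cases "w ! p \<in> bottoms w")
    case False
    have "p < length w" "w ! p < w ! m" using Suc.prems(1,4) d by simp_all
    then obtain i where i: "m < i" "i < p" "w ! i \<in> bottoms w" "w ! i < w ! p"
      using Suc.IH False mp by blast
    then have "w ! i < w ! Suc p" "i < Suc p" using d by simp_all
    then show ?thesis using i by blast
  next
    case True
    then show ?thesis using mp d lessI by blast
  qed
qed simp

lemma smaller_bottom_before:
  assumes "distinct w"
  shows "p < length w \<Longrightarrow> w ! p \<notin> bottoms w \<Longrightarrow> \<exists>i<p. w ! i \<in> bottoms w \<and> w ! i < w ! p"
proof (induction p)
  case 0
  then show ?case using nth_in_bottoms[OF assms, of 0] by simp
next
  case (Suc p)
  have "w ! p \<noteq> w ! Suc p" using assms Suc.prems(1) by (simp add: nth_eq_iff_index_eq)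
  then have d: "w ! p < w ! Suc p" using nth_in_bottoms[OF assms Suc.prems(1)] Suc.prems(2) by simp
  show ?case
  proof (cases "w ! p \<in> bottoms w")
    case False
    have "p < length w" using Suc.prems(1) by simp
    then obtain i where i: "i < p" "w ! i \<in> bottoms w" "w ! i < w ! p"
      using Suc.IH False by blast
    then have "w ! i < w ! Suc p" "i < Suc p" using d by simp_all
    then show ?thesis using i by blast
  next
    case True
    then show ?thesis using d lessI by blast
  qed
qed

text \<open>
  Let \<open>x < y\<close> be the letters of the two words at the first place \<open>m\<close> where they differ. If both
  are bottoms, then the first word has a larger non-bottom between \<open>x\<close> and \<open>y\<close>, which the second
  word has after \<open>y\<close>. If neither is, then the second word has a smaller bottom between \<open>y\<close> and \<open>x\<close>,
  which the first word has after \<open>x\<close>. If only \<open>x\<close> is a bottom, \<open>x\<close> and \<open>y\<close> themselves are in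
  different order. If only \<open>y\<close> is, the common previous letter is below \<open>x\<close> and above \<open>y\<close>.
\<close>

lemma first_difference:
  assumes w: "w \<in> perms n" "w' \<in> perms n" and R: "bottoms w = bottoms w'"
    and ord: "\<And>r c. r \<in> bottoms w \<Longrightarrow> c \<in> {1..n} - bottoms w \<Longrightarrow> r < c \<Longrightarrow> before w r c \<longleftrightarrow> before w' r c"
    and m: "m < n" "\<forall>i<m. w ! i = w' ! i"
  shows "\<not> w ! m < w' ! m"
proof
  assume lt: "w ! m < w' ! m"
  have d: "distinct w" "distinct w'" and st: "set w = {1..n}" "set w' = {1..n}" using w by (auto simp: perms_def)
  have l: "length w = n" "length w' = n" using w perms_length by auto
  have later: "\<exists>j. m < j \<and> j < n \<and> w' ! j = w ! i" if "m \<le> i" "i < n" "w ! i \<noteq> w' ! m" for i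
  proof -
    have "w ! i \<in> set w'" using that l st nth_mem by metis
    then obtain j where j: "j < n" "w' ! j = w ! i" using l by (auto simp: in_set_conv_nth)
    have "\<not> j < m"
    proof
      assume "j < m"
      then have "w ! j = w ! i" using m(2) j by simp
      then have "j = i" using d(1) l j that by (simp add: nth_eq_iff_index_eq)
      then show False using \<open>j < m\<close> that by simp
    qed
    then show ?thesis using j that by (metis linorder_neqE_nat)
  qed
  have later': "\<exists>j. m < j \<and> j < n \<and> w ! j = w' ! i" if "m \<le> i" "i < n" "w' ! i \<noteq> w ! m" for i
  proof -
    have "w' ! i \<in> set w" using that l st nth_mem by metis
    then obtain j where j: "j < n" "w ! j = w' ! i" using l by (auto simp: in_set_conv_nth)
    have "\<not> j < m"
    proof
      assume "j < m"
      then have "w' ! j = w' ! i" using m(2) j by simp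
      then have "j = i" using d(2) l j that by (simp add: nth_eq_iff_index_eq)
      then show False using \<open>j < m\<close> that by simp
    qed
    then show ?thesis using j that by (metis linorder_neqE_nat)
  qed
  obtain p where p: "m < p" "p < n" "w ! p = w' ! m" using later'[of m] m lt by auto
  obtain q where q: "m < q" "q < n" "w' ! q = w ! m" using later[of m] m lt by auto
  have rng: "w ! i \<in> {1..n}" "w' ! i \<in> {1..n}" if "i < n" for i using that l st nth_mem by metis+
  show False
  proof (cases "w ! m \<in> bottoms w"; cases "w' ! m \<in> bottoms w")
    assume "w ! m \<in> bottoms w" and y: "w' ! m \<in> bottoms w"
    obtain i where i: "m < i" "i < p" "w ! i \<notin> bottoms w" "w ! p < w ! i"
      using top_before_bottom[OF d(1), of p m] p y lt l by auto
    have "\<not> before w (w ! p) (w ! i)" using before_nth[OF d(1), of p i] l p i by simp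
    moreover have "before w' (w ! p) (w ! i)"
      using later[of i] i p l before_nth[OF d(2), of m] m by force
    moreover have "w ! i \<in> {1..n} - bottoms w" using rng[of i] i p by simp
    ultimately show False using ord[of "w ! p" "w ! i"] i(4) p(3) y by simp
  next
    assume x: "w ! m \<notin> bottoms w" and "w' ! m \<notin> bottoms w"
    obtain i where i: "m < i" "i < q" "w' ! i \<in> bottoms w" "w' ! i < w' ! q"
      using bottom_before_top[OF d(2), of q m] q x lt l R by auto
    have "before w' (w' ! i) (w' ! q)" using before_nth[OF d(2), of i q] l q i by simp
    moreover have "\<not> before w (w' ! i) (w' ! q)"
    proof -
      obtain j where "m < j" "j < n" "w ! j = w' ! i" using later'[of i] i q by auto
      then show ?thesis using before_nth[OF d(1), of j m] l m q(3) by simp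
    qed
    moreover have "w' ! q \<in> {1..n} - bottoms w" using rng[of q] q x by simp
    ultimately show False using ord[of "w' ! i" "w' ! q"] i by simp
  next
    assume x: "w ! m \<in> bottoms w" and y: "w' ! m \<notin> bottoms w"
    have "before w (w ! m) (w' ! m)" using before_nth[OF d(1), of m p] l p m by simp
    moreover have "\<not> before w' (w ! m) (w' ! m)" using before_nth[OF d(2), of q m] l q m by simp
    ultimately show False using ord[OF x _ lt] rng[of m] m y by simp
  next
    assume x: "w ! m \<notin> bottoms w" and y: "w' ! m \<in> bottoms w"
    have m0: "m \<noteq> 0" using x nth_in_bottoms[OF d(1), of m] m l by auto
    have "w ! (m - 1) \<noteq> w ! m" using nth_eq_iff_index_eq[OF d(1), of "m - 1" m] m(1) l m0 by simp
    then have "w ! (m - 1) < w ! m" using x nth_in_bottoms[OF d(1), of m] m l by auto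
    moreover have "w' ! m < w' ! (m - 1)" using y R nth_in_bottoms[OF d(2), of m] m l m0 by auto
    ultimately show False using m(2) m0 lt by simp
  qed
qed

lemma perms_determined:
  assumes w: "w \<in> perms n" "w' \<in> perms n" and R: "bottoms w = bottoms w'"
    and ord: "\<And>r c. r \<in> bottoms w \<Longrightarrow> c \<in> {1..n} - bottoms w \<Longrightarrow> r < c \<Longrightarrow> before w r c \<longleftrightarrow> before w' r c"
  shows "w = w'"
proof (rule nth_equalityI)
  show "length w = length w'" using w perms_length by auto
  show "w ! i = w' ! i" if "i < length w" for i
    using that
  proof (induction i rule: less_induct)
    case (less m)
    then have m: "m < n" "\<forall>i<m. w ! i = w' ! i" "\<forall>i<m. w' ! i = w ! i" using perms_length[OF w(1)] by auto
    have "\<not> w ! m < w' ! m" using first_difference[OF w R ord m(1,2)] .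
    moreover have "\<not> w' ! m < w ! m" using first_difference[OF w(2,1) R[symmetric] _ m(1,3)] ord R by simp
    ultimately show ?case by simp
  qed
qed

section \<open>Reading a NEW-tableau\<close>

text \<open>
  The two forbidden patterns are one: the row indices and the column indices need only be distinct.
\<close>

lemma NEW_no_crossing:
  assumes "NEW_tableau T" "has_zero T i j" "has_zero T i' j'" "has_one T i j'"
  shows "\<not> has_one T i' j"
proof
  assume o: "has_one T i' j"
  have ne: "i \<noteq> i'" "j \<noteq> j'" using assms o by (auto simp: has_zero_def has_one_def)
  have N: "\<not> (has_zero T a b \<and> has_zero T a' b' \<and> has_one T a b' \<and> has_one T a' b)"
          "\<not> (has_one T a b \<and> has_one T a' b' \<and> has_zero T a b' \<and> has_zero T a' b)"
    if "a < a'" "b < b'" for a a' b b'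
    using assms(1) that unfolding NEW_tableau_def by blast+
  show False
    using N[of i i' j j'] N[of i i' j' j] N[of i' i j j'] N[of i' i j' j] ne assms o
    by (cases i i' rule: linorder_cases; cases j j' rule: linorder_cases) blast+
qed

text \<open>
  As long as rows and columns remain, some row is full or some column is empty, so the reading
  never gets stuck. For if every remaining row had a 0 and every remaining column a 1, consider the
  columns \<open>Z\<close> in which the top row has a 0. A row with a 1 in \<open>Z\<close> has no 0 at a column where the top
  row has a 1, so its zeros lie in \<open>Z\<close>, and these rows together with \<open>Z\<close> form a smaller
  counterexample. The top row is used because it meets every column that is met by another row.
\<close>

lemma NEW_progress:
  assumes "NEW_tableau T" "finite R" "\<forall>i\<in>R. \<exists>j\<in>C. has_zero T i j" "\<forall>j\<in>C. \<exists>i\<in>R. has_one T i j"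
  shows "R = {}"
  using assms(2-)
proof (induction "card R" arbitrary: R C rule: less_induct)
  case less
  show ?case
  proof (rule ccontr)
    assume ne: "R \<noteq> {}"
    define i0 where "i0 = Min R"
    have i0: "i0 \<in> R" "i \<in> R \<Longrightarrow> i0 \<le> i" for i using ne less.prems(1) by (auto simp: i0_def)
    have top: "in_diagram T i0 j" if "i \<in> R" "in_diagram T i j" for i j
    proof (cases "i = i0")
      case False
      have il: "i < length T" "j < length (T ! i)" using that(2) by (auto simp: in_diagram_def)
      have "i0 < i" using i0(2)[OF that(1)] False by simp
      moreover from this have "length (T ! i) \<le> length (T ! i0)"
        using assms(1) il(1) unfolding NEW_tableau_def ferrers_iff by blast
      ultimately show ?thesis using il by (simp add: in_diagram_def)
    qed (use that in simp)
    define Z where "Z = {j \<in> C. has_zero T i0 j}"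
    define R1 where "R1 = {i \<in> R. \<exists>j\<in>Z. has_one T i j}"
    have "i0 \<notin> R1" by (auto simp: R1_def Z_def has_one_def has_zero_def)
    then have "R1 \<subset> R" using i0(1) by (auto simp: R1_def)
    then have c: "card R1 < card R" "finite R1" using less.prems(1) psubset_card_mono finite_subset by blast+
    have r: "\<exists>j\<in>Z. has_zero T i j" if i: "i \<in> R1" for i
    proof -
      have iR: "i \<in> R" using i by (simp add: R1_def)
      obtain j where j: "j \<in> C" "has_zero T i j" using less.prems(2) iR by blast
      obtain j' where j': "j' \<in> Z" "has_one T i j'" using i by (auto simp: R1_def)
      have "\<not> has_one T i0 j" using NEW_no_crossing[OF assms(1) j(2) _ j'(2), of i0] j' by (auto simp: Z_def)
      moreover have "in_diagram T i0 j" using top[OF iR] j by (auto simp: has_zero_def)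
      ultimately have "j \<in> Z" using j by (auto simp: Z_def has_zero_def has_one_def)
      then show ?thesis using j by blast
    qed
    have o: "\<exists>i\<in>R1. has_one T i j" if j: "j \<in> Z" for j
    proof -
      obtain i where "i \<in> R" "has_one T i j" using less.prems(3) j unfolding Z_def by blast
      then have "i \<in> R1" "has_one T i j" using j unfolding R1_def by blast+
      then show ?thesis by blast
    qed
    then have "R1 = {}" using less.hyps[OF c] r by blast
    moreover obtain j where "j \<in> Z" using less.prems(2) i0(1) unfolding Z_def by blast
    ultimately show False using o by blast
  qed
qed

text \<open>
  On the letters of \<open>w\<close>, being in \<open>A\<close> and being in \<open>bottoms w\<close> are the same. A prefix of a word
  need not contain all of \<open>A\<close>, which is why this is not stated as an equation of sets.
\<close>

definition bottoms_match :: "nat set \<Rightarrow> nat list \<Rightarrow> bool" where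
  "bottoms_match A w \<longleftrightarrow> (\<forall>k<length w. w ! k \<in> A \<longleftrightarrow> k = 0 \<or> w ! k < w ! (k - 1))"

lemma bottoms_match_Nil: "bottoms_match A []"
  by (simp add: bottoms_match_def)

lemma bottoms_match_snoc: "bottoms_match A (w @ [x]) \<longleftrightarrow> bottoms_match A w \<and> (x \<in> A \<longleftrightarrow> w = [] \<or> x < last w)"
proof -
  have "bottoms_match A (w @ [x]) \<longleftrightarrow>
      (\<forall>k<length w. (w @ [x]) ! k \<in> A \<longleftrightarrow> k = 0 \<or> (w @ [x]) ! k < (w @ [x]) ! (k - 1)) \<and>
      (x \<in> A \<longleftrightarrow> length w = 0 \<or> x < (w @ [x]) ! (length w - 1))"
    unfolding bottoms_match_def length_append_singleton All_less_Suc by (auto simp: nth_append)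
  moreover have "(w @ [x]) ! k = w ! k \<and> (w @ [x]) ! (k - 1) = w ! (k - 1)" if "k < length w" for k
    using that by (auto simp: nth_append)
  moreover have "(w @ [x]) ! (length w - 1) = last w" if "w \<noteq> []"
    using that by (auto simp: nth_append last_conv_nth)
  ultimately show ?thesis unfolding bottoms_match_def by (cases "w = []") simp_all
qed

lemma bottoms_match_asc:
  "bottoms_match A w \<Longrightarrow> sorted_wrt (<) b \<Longrightarrow> set b \<inter> A = {} \<Longrightarrow> (\<forall>x\<in>set b. w \<noteq> [] \<and> last w < x) \<Longrightarrow> bottoms_match A (w @ b)"
proof (induction b arbitrary: w)
  case (Cons x b)
  have "bottoms_match A (w @ [x])" using Cons.prems by (auto simp: bottoms_match_snoc)
  then have "bottoms_match A ((w @ [x]) @ b)" using Cons.prems by (intro Cons.IH) auto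
  then show ?case by simp
qed simp

lemma bottoms_match_desc:
  "bottoms_match A w \<Longrightarrow> sorted_wrt (>) b \<Longrightarrow> set b \<subseteq> A \<Longrightarrow> (\<forall>x\<in>set b. w = [] \<or> x < last w) \<Longrightarrow> bottoms_match A (w @ b)"
proof (induction b arbitrary: w)
  case (Cons x b)
  have "bottoms_match A (w @ [x])" using Cons.prems by (auto simp: bottoms_match_snoc)
  then have "bottoms_match A ((w @ [x]) @ b)" using Cons.prems by (intro Cons.IH) auto
  then show ?case by simp
qed simp

lemma bottoms_match_bottoms: "bottoms_match A w \<Longrightarrow> distinct w \<Longrightarrow> A \<subseteq> set w \<Longrightarrow> bottoms w = A"
  by (auto simp: bottoms_match_def bottoms_def in_set_conv_nth) (metis in_set_conv_nth subsetD)+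

lemma before_set: "before w x y \<Longrightarrow> x \<in> set w \<and> y \<in> set w"
  by (auto simp: before_def)

lemma before_append:
  "before (xs @ ys) x y \<longleftrightarrow> before xs x y \<or> before ys x y \<or> (x \<in> set xs \<and> y \<in> set ys)"
proof
  assume "before (xs @ ys) x y"
  then obtain i j where ij: "i < j" "j < length xs + length ys" "(xs @ ys) ! i = x" "(xs @ ys) ! j = y"
    by (auto simp: before_def)
  consider "j < length xs" | "i < length xs" "length xs \<le> j" | "length xs \<le> i" by linarith
  then show "before xs x y \<or> before ys x y \<or> (x \<in> set xs \<and> y \<in> set ys)"
  proof cases
    case 1
    then have "before xs x y" using ij unfolding before_def by (intro exI[of _ i] exI[of _ j]) (auto simp: nth_append)
    then show ?thesis by simp
  next
    case 2
    then have "x \<in> set xs" "y \<in> set ys" using ij by (auto simp: nth_append)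
    then show ?thesis by simp
  next
    case 3
    then have "before ys x y" using ij unfolding before_def
      by (intro exI[of _ "i - length xs"] exI[of _ "j - length xs"]) (auto simp: nth_append)
    then show ?thesis by simp
  qed
next
  assume "before xs x y \<or> before ys x y \<or> (x \<in> set xs \<and> y \<in> set ys)"
  then consider "before xs x y" | "before ys x y" | "x \<in> set xs" "y \<in> set ys" by blast
  then show "before (xs @ ys) x y"
  proof cases
    case 1
    then obtain i j where "i < j" "j < length xs" "xs ! i = x" "xs ! j = y" by (auto simp: before_def)
    then show ?thesis unfolding before_def by (intro exI[of _ i] exI[of _ j]) (auto simp: nth_append)
  next
    case 2
    then obtain i j where "i < j" "j < length ys" "ys ! i = x" "ys ! j = y" by (auto simp: before_def)
    then show ?thesis unfolding before_def
      by (intro exI[of _ "i + length xs"] exI[of _ "j + length xs"]) (auto simp: nth_append)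
  next
    case 3
    then obtain i j where "i < length xs" "j < length ys" "xs ! i = x" "ys ! j = y" by (auto simp: in_set_conv_nth)
    then show ?thesis unfolding before_def
      by (intro exI[of _ i] exI[of _ "j + length xs"]) (auto simp: nth_append)
  qed
qed

lemma before_asym: "distinct w \<Longrightarrow> before w x y \<Longrightarrow> \<not> before w y x"
  unfolding before_def by (metis nth_eq_iff_index_eq order.strict_trans less_asym)

lemma before_total: "x \<in> set w \<Longrightarrow> y \<in> set w \<Longrightarrow> x \<noteq> y \<Longrightarrow> before w x y \<or> before w y x"
  unfolding before_def in_set_conv_nth by (metis linorder_neqE_nat)

lemma before_trans: "distinct w \<Longrightarrow> before w x y \<Longrightarrow> before w y z \<Longrightarrow> before w x z"
  unfolding before_def by (metis nth_eq_iff_index_eq order.strict_trans)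

context
  fixes T n
  assumes cov: "T \<in> covered n"
begin

text \<open>
  What holds at each moment of the reading, also between the two halves of a round, with \<open>C\<close> and
  \<open>R\<close> unread. Nothing is said about cells whose row and column are both unread.
\<close>

definition reading :: "nat list \<Rightarrow> nat list \<Rightarrow> nat list \<Rightarrow> bool" where
  "reading C R w \<longleftrightarrow>
     sorted_wrt (<) C \<and> sorted_wrt (<) R \<and> set C \<subseteq> {..<num_cols T} \<and> set R \<subseteq> {..<length T} \<and>
     distinct w \<and> set w \<subseteq> {1..n} \<and> bottoms_match (row_labels T) w \<and>
     (\<forall>i<length T. label T (Vert i) \<in> set w \<longleftrightarrow> i \<notin> set R) \<and>
     (\<forall>j<num_cols T. label T (Horiz j) \<in> set w \<longleftrightarrow> j \<notin> set C) \<and>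
     (\<forall>i j. in_diagram T i j \<longrightarrow> i \<notin> set R \<or> j \<notin> set C \<longrightarrow>
        (has_one T i j \<longleftrightarrow> i \<notin> set R \<and> (j \<in> set C \<or> before w (label T (Vert i)) (label T (Horiz j)))))"

lemma in_diagram_bounds: "in_diagram T i j \<Longrightarrow> i < length T \<and> j < num_cols T"
  using cov in_diagram_num_cols by (auto simp: covered_def in_diagram_def)

lemma label_cases:
  "i < length T \<Longrightarrow> i' < length T \<Longrightarrow> label T (Vert i) = label T (Vert i') \<longleftrightarrow> i = i'"
  "j < num_cols T \<Longrightarrow> j' < num_cols T \<Longrightarrow> label T (Horiz j) = label T (Horiz j') \<longleftrightarrow> j = j'"
  "i < length T \<Longrightarrow> j < num_cols T \<Longrightarrow> label T (Vert i) \<noteq> label T (Horiz j)"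
proof -
  note b = border_covered[OF cov]
  have inj: "s \<in> set (border T) \<Longrightarrow> s' \<in> set (border T) \<Longrightarrow> label T s = label T s' \<longleftrightarrow> s = s'" for s s'
    using label_inj by blast
  show "i < length T \<Longrightarrow> i' < length T \<Longrightarrow> label T (Vert i) = label T (Vert i') \<longleftrightarrow> i = i'"
    "j < num_cols T \<Longrightarrow> j' < num_cols T \<Longrightarrow> label T (Horiz j) = label T (Horiz j') \<longleftrightarrow> j = j'"
    "i < length T \<Longrightarrow> j < num_cols T \<Longrightarrow> label T (Vert i) \<noteq> label T (Horiz j)"
    using b inj[of "Vert i" "Vert i'"] inj[of "Horiz j" "Horiz j'"] inj[of "Vert i" "Horiz j"] by simp_all
qed

lemma Horiz_label_iff: "c \<in> {1..n} - row_labels T \<longleftrightarrow> (\<exists>j<num_cols T. c = label T (Horiz j))"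
proof
  assume c: "c \<in> {1..n} - row_labels T"
  then obtain s where s: "s \<in> set (border T)" "c = label T s"
    using label_bij[OF cov] unfolding bij_betw_def by (metis Diff_iff image_iff)
  then have "s \<in> Vert ` {..<length T} \<union> Horiz ` {..<num_cols T}" using border_covered[OF cov] by blast
  then show "\<exists>j<num_cols T. c = label T (Horiz j)"
    using c s(2) unfolding row_labels_def by blast
next
  assume "\<exists>j<num_cols T. c = label T (Horiz j)"
  then obtain j where j: "j < num_cols T" "c = label T (Horiz j)" by blast
  then show "c \<in> {1..n} - row_labels T"
    using label_range(2)[OF cov j(1)] label_cases(3)[OF _ j(1)] by (fastforce simp: row_labels_def)
qed

lemma label_blocks:
  "sorted_wrt (<) C \<Longrightarrow> set C \<subseteq> {..<num_cols T} \<Longrightarrow> sorted_wrt (<) (map (\<lambda>j. label T (Horiz j)) (rev C))"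
  "sorted_wrt (<) R \<Longrightarrow> set R \<subseteq> {..<length T} \<Longrightarrow> sorted_wrt (>) (map (\<lambda>i. label T (Vert i)) (rev R))"
proof -
  show "sorted_wrt (<) (map (\<lambda>j. label T (Horiz j)) (rev C))" if "sorted_wrt (<) C" "set C \<subseteq> {..<num_cols T}"
    using that label_order(2)[OF cov] unfolding sorted_wrt_map sorted_wrt_rev
    by (auto elim!: sorted_wrt_mono_rel[rotated])
  show "sorted_wrt (>) (map (\<lambda>i. label T (Vert i)) (rev R))" if "sorted_wrt (<) R" "set R \<subseteq> {..<length T}"
    using that label_order(1)[OF cov] unfolding sorted_wrt_map sorted_wrt_rev
    by (auto elim!: sorted_wrt_mono_rel[rotated])
qed

lemma reading_columns:
  assumes r: "reading C R w"
    and no: "\<And>j i. j \<in> set C \<Longrightarrow> P j \<Longrightarrow> i \<in> set R \<Longrightarrow> \<not> has_one T i j"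
    and lt: "\<And>j. j \<in> set C \<Longrightarrow> P j \<Longrightarrow> w \<noteq> [] \<and> last w < label T (Horiz j)"
  shows "reading (filter (\<lambda>j. \<not> P j) C) R (w @ map (\<lambda>j. label T (Horiz j)) (rev (filter P C)))"
proof -
  let ?C = "filter (\<lambda>j. \<not> P j) C"
  let ?b = "map (\<lambda>j. label T (Horiz j)) (rev (filter P C))"
  have C: "sorted_wrt (<) C" "set C \<subseteq> {..<num_cols T}" and R: "sorted_wrt (<) R" "set R \<subseteq> {..<length T}"
    and w: "distinct w" "set w \<subseteq> {1..n}" "bottoms_match (row_labels T) w"
    and wV: "\<And>i. i < length T \<Longrightarrow> label T (Vert i) \<in> set w \<longleftrightarrow> i \<notin> set R"
    and wH: "\<And>j. j < num_cols T \<Longrightarrow> label T (Horiz j) \<in> set w \<longleftrightarrow> j \<notin> set C"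
    and one: "\<And>i j. in_diagram T i j \<Longrightarrow> i \<notin> set R \<or> j \<notin> set C \<Longrightarrow>
        has_one T i j \<longleftrightarrow> i \<notin> set R \<and> (j \<in> set C \<or> before w (label T (Vert i)) (label T (Horiz j)))"
    using r unfolding reading_def by blast+
  have Cj: "j < num_cols T" if "j \<in> set C" for j using C that by auto
  have sb: "sorted_wrt (<) ?b" using label_blocks(1)[of "filter P C"] C by (auto simp: sorted_wrt_filter)
  have bset: "x \<in> set ?b \<longleftrightarrow> (\<exists>j\<in>set C. P j \<and> x = label T (Horiz j))" for x by auto
  have bH: "label T (Horiz j) \<in> set ?b \<longleftrightarrow> j \<in> set C \<and> P j" if "j < num_cols T" for j
    unfolding bset using label_cases(2)[OF that Cj] by auto
  have bV: "label T (Vert i) \<notin> set ?b" if "i < length T" for i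
    unfolding bset using label_cases(3)[OF that Cj] by metis
  have bn: "set ?b \<subseteq> {1..n}" using label_range(2)[OF cov Cj] by auto
  have d: "distinct (w @ ?b)"
  proof -
    have "distinct ?b" using sb by (simp only: strict_sorted_iff)
    moreover have "x \<notin> set ?b" if "x \<in> set w" for x unfolding bset using that wH Cj by auto
    ultimately show ?thesis using w(1) by auto
  qed
  have "set ?b \<inter> row_labels T = {}" using bV unfolding row_labels_def by blast
  then have g: "bottoms_match (row_labels T) (w @ ?b)"
    using bottoms_match_asc[OF w(3) sb] lt by auto
  have o: "has_one T i j \<longleftrightarrow> i \<notin> set R \<and> (j \<in> set ?C \<or> before (w @ ?b) (label T (Vert i)) (label T (Horiz j)))"
    if ij: "in_diagram T i j" "i \<notin> set R \<or> j \<notin> set ?C" for i j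
  proof -
    have b: "i < length T" "j < num_cols T" using in_diagram_bounds ij by auto
    have "before ?b (label T (Vert i)) (label T (Horiz j)) \<longleftrightarrow> False" using bV[OF b(1)] before_set[of ?b] by blast
    then have bf: "before (w @ ?b) (label T (Vert i)) (label T (Horiz j)) \<longleftrightarrow>
        before w (label T (Vert i)) (label T (Horiz j)) \<or> (i \<notin> set R \<and> j \<in> set C \<and> P j)"
      unfolding before_append using wV[OF b(1)] bH[OF b(2)] by blast
    show ?thesis
    proof (cases "i \<in> set R")
      case True
      then show ?thesis using ij one[OF ij(1)] no[of j i] by auto
    next
      case False
      then show ?thesis using one[OF ij(1)] bf by auto
    qed
  qed
  show ?thesis unfolding reading_def
    using C R w d g bn o wV wH bV bH by (auto simp: sorted_wrt_filter simp del: set_map set_rev)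
qed

lemma reading_rows:
  assumes r: "reading C R w"
    and no: "\<And>i j. i \<in> set R \<Longrightarrow> P i \<Longrightarrow> j \<in> set C \<Longrightarrow> \<not> has_zero T i j"
    and lt: "\<And>i. i \<in> set R \<Longrightarrow> P i \<Longrightarrow> w = [] \<or> label T (Vert i) < last w"
  shows "reading C (filter (\<lambda>i. \<not> P i) R) (w @ map (\<lambda>i. label T (Vert i)) (rev (filter P R)))"
proof -
  let ?R = "filter (\<lambda>i. \<not> P i) R"
  let ?b = "map (\<lambda>i. label T (Vert i)) (rev (filter P R))"
  have C: "sorted_wrt (<) C" "set C \<subseteq> {..<num_cols T}" and R: "sorted_wrt (<) R" "set R \<subseteq> {..<length T}"
    and w: "distinct w" "set w \<subseteq> {1..n}" "bottoms_match (row_labels T) w"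
    and wV: "\<And>i. i < length T \<Longrightarrow> label T (Vert i) \<in> set w \<longleftrightarrow> i \<notin> set R"
    and wH: "\<And>j. j < num_cols T \<Longrightarrow> label T (Horiz j) \<in> set w \<longleftrightarrow> j \<notin> set C"
    and one: "\<And>i j. in_diagram T i j \<Longrightarrow> i \<notin> set R \<or> j \<notin> set C \<Longrightarrow>
        has_one T i j \<longleftrightarrow> i \<notin> set R \<and> (j \<in> set C \<or> before w (label T (Vert i)) (label T (Horiz j)))"
    using r unfolding reading_def by blast+
  have Ri: "i < length T" if "i \<in> set R" for i using R that by auto
  have sb: "sorted_wrt (>) ?b" using label_blocks(2)[of "filter P R"] R by (auto simp: sorted_wrt_filter)
  have bset: "x \<in> set ?b \<longleftrightarrow> (\<exists>i\<in>set R. P i \<and> x = label T (Vert i))" for x by auto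
  have bV: "label T (Vert i) \<in> set ?b \<longleftrightarrow> i \<in> set R \<and> P i" if "i < length T" for i
    unfolding bset using label_cases(1)[OF that Ri] by auto
  have bH: "label T (Horiz j) \<notin> set ?b" if "j < num_cols T" for j
    unfolding bset using label_cases(3)[OF Ri that] by metis
  have bn: "set ?b \<subseteq> {1..n}" using label_range(1)[OF cov Ri] by auto
  have d: "distinct (w @ ?b)"
  proof -
    have "sorted_wrt (<) (rev ?b)" using sb unfolding sorted_wrt_rev .
    then have "distinct ?b" by (simp only: strict_sorted_iff distinct_rev)
    moreover have "x \<notin> set ?b" if "x \<in> set w" for x unfolding bset using that wV Ri by auto
    ultimately show ?thesis using w(1) by auto
  qed
  have "set ?b \<subseteq> row_labels T" using Ri by (auto simp: row_labels_def)
  then have g: "bottoms_match (row_labels T) (w @ ?b)"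
    using bottoms_match_desc[OF w(3) sb] lt by auto
  have o: "has_one T i j \<longleftrightarrow> i \<notin> set ?R \<and> (j \<in> set C \<or> before (w @ ?b) (label T (Vert i)) (label T (Horiz j)))"
    if ij: "in_diagram T i j" "i \<notin> set ?R \<or> j \<notin> set C" for i j
  proof -
    have b: "i < length T" "j < num_cols T" using in_diagram_bounds ij by auto
    have "before ?b (label T (Vert i)) (label T (Horiz j)) \<longleftrightarrow> False" using bH[OF b(2)] before_set[of ?b] by blast
    then have bf: "before (w @ ?b) (label T (Vert i)) (label T (Horiz j)) \<longleftrightarrow>
        before w (label T (Vert i)) (label T (Horiz j))"
      unfolding before_append using bH[OF b(2)] by blast
    have wi: "before w (label T (Vert i)) (label T (Horiz j)) \<Longrightarrow> i \<notin> set R" using wV[OF b(1)] before_set[of w] by blast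
    show ?thesis
    proof (cases "i \<in> set R \<and> j \<in> set C")
      case True
      then show ?thesis using ij no[of i j] by (auto simp: has_zero_def has_one_def)
    next
      case False
      then show ?thesis using one[OF ij(1)] bf wi ij by auto
    qed
  qed
  show ?thesis unfolding reading_def
    using C R w d g bn o wV wH bV bH by (auto simp: sorted_wrt_filter simp del: set_map set_rev)
qed

text \<open>
  Between rounds, every unread row still has a 0 among the unread columns. A column that has just
  become empty had a 1 in one of the rows read last, whence the comparison with the last letter,
  the label of the topmost of these rows. At the start nothing can be said about the rows, but no
  column is empty.
\<close>

definition round_inv :: "nat list \<times> nat list \<times> nat list \<Rightarrow> bool" where
  "round_inv = (\<lambda>(C, R, w). reading C R w \<and>
     (w = [] \<longrightarrow> (\<forall>j\<in>set C. \<exists>i\<in>set R. has_one T i j)) \<and>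
     (w \<noteq> [] \<longrightarrow> (\<forall>i\<in>set R. \<exists>j\<in>set C. has_zero T i j) \<and>
       (\<forall>j\<in>set C. (\<forall>i\<in>set R. \<not> has_one T i j) \<longrightarrow> last w < label T (Horiz j))))"

lemma last_map_rev: "xs \<noteq> [] \<Longrightarrow> last (ys @ map f (rev xs)) = f (hd xs)"
  by (simp add: last_map last_rev)

lemma sorted_hd_le: "sorted_wrt (<) xs \<Longrightarrow> x \<in> set xs \<Longrightarrow> hd xs \<le> (x::nat)"
  by (cases xs) auto

lemma round_inv_step:
  assumes new: "NEW_tableau T" and inv: "round_inv (C, R, w)" and go: "C \<noteq> [] \<or> R \<noteq> []"
    and s': "Psi_round T (C, R, w) = (C', R', w')"
  shows "round_inv (C', R', w') \<and> length C' + length R' < length C + length R"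
proof -
  define P where "P j \<longleftrightarrow> (\<forall>i\<in>set R. \<not> has_one T i j)" for j
  define Q where "Q i \<longleftrightarrow> (\<forall>j\<in>set (filter (\<lambda>j. \<not> P j) C). \<not> has_zero T i j)" for i
  define b where "b = map (\<lambda>j. label T (Horiz j)) (rev (filter P C))"
  define c where "c = map (\<lambda>i. label T (Vert i)) (rev (filter Q R))"
  have C': "C' = filter (\<lambda>j. \<not> P j) C" and R': "R' = filter (\<lambda>i. \<not> Q i) R" and w': "w' = (w @ b) @ c"
    using s' unfolding Psi_round_def Let_def P_def Q_def b_def c_def by auto
  have r: "reading C R w" and init: "w = [] \<Longrightarrow> j \<in> set C \<Longrightarrow> \<not> P j"
    and zero: "w \<noteq> [] \<Longrightarrow> i \<in> set R \<Longrightarrow> \<exists>j\<in>set C. has_zero T i j"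
    and last: "w \<noteq> [] \<Longrightarrow> j \<in> set C \<Longrightarrow> P j \<Longrightarrow> last w < label T (Horiz j)" for i j
    using inv unfolding round_inv_def P_def by auto
  have C: "sorted_wrt (<) C" "set C \<subseteq> {..<num_cols T}" and R: "sorted_wrt (<) R" "set R \<subseteq> {..<length T}"
    using r unfolding reading_def by blast+
  have r1: "reading C' R (w @ b)" unfolding C' b_def
  proof (rule reading_columns[OF r])
    show "\<not> has_one T i j" if "j \<in> set C" "P j" "i \<in> set R" for i j using that by (simp add: P_def)
    show "w \<noteq> [] \<and> last w < label T (Horiz j)" if "j \<in> set C" "P j" for j using that init last by blast
  qed
  have Qlt: "w @ b = [] \<or> label T (Vert i) < last (w @ b)" if i: "i \<in> set R" "Q i" for i
  proof (cases "w = []")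
    case True
    then have "filter P C = []" using init by (simp add: filter_empty_conv)
    then show ?thesis using True by (simp add: b_def)
  next
    case False
    obtain j where j: "j \<in> set C" "has_zero T i j" using zero[OF False i(1)] by blast
    have Pj: "P j" using i(2) j by (auto simp: Q_def)
    then have jf: "j \<in> set (filter P C)" using j by simp
    then have ne: "filter P C \<noteq> []" by (metis empty_iff empty_set)
    have hd: "hd (filter P C) \<le> j" "hd (filter P C) < num_cols T"
      using sorted_hd_le[OF _ jf] C hd_in_set[OF ne] by (auto simp: sorted_wrt_filter)
    have "label T (Vert i) < label T (Horiz j)"
      using j label_order(3)[OF cov, of i j] in_diagram_bounds[of i j] by (simp add: has_zero_def)
    also have "\<dots> \<le> label T (Horiz (hd (filter P C)))"
      using label_order(2)[OF cov, of "hd (filter P C)" j] hd j C by (cases "hd (filter P C) = j") auto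
    finally show ?thesis using last_map_rev[OF ne, of w] by (simp add: b_def)
  qed
  have r2: "reading C' R' w'" unfolding R' w' c_def
  proof (rule reading_rows[OF r1])
    show "\<not> has_zero T i j" if "i \<in> set R" "Q i" "j \<in> set C'" for i j using that by (simp add: Q_def C')
    show "w @ b = [] \<or> label T (Vert i) < last (w @ b)" if "i \<in> set R" "Q i" for i using Qlt that by blast
  qed
  have C'one: "\<exists>i\<in>set R. has_one T i j" if "j \<in> set C'" for j using that by (auto simp: C' P_def)
  have progress: "filter P C \<noteq> [] \<or> filter Q R \<noteq> []"
  proof (rule ccontr)
    assume a: "\<not> (filter P C \<noteq> [] \<or> filter Q R \<noteq> [])"
    then have e: "\<not> P j" "\<not> Q i" if "j \<in> set C" "i \<in> set R" for i j
      using that by (auto simp: filter_empty_conv)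
    have "\<forall>i\<in>set R. \<exists>j\<in>set C'. has_zero T i j"
      using a by (auto simp: Q_def C' filter_empty_conv)
    then have R0: "set R = {}" using NEW_progress[OF new finite_set] C'one by blast
    moreover have "set C = {}"
    proof -
      have "P j" for j using R0 by (simp add: P_def)
      then show ?thesis using a by (simp add: filter_empty_conv)
    qed
    ultimately show False using go by simp
  qed
  have "w' \<noteq> []" using progress unfolding w' b_def c_def by auto
  moreover have "\<exists>j\<in>set C'. has_zero T i j" if "i \<in> set R'" for i using that by (auto simp: R' Q_def C')
  moreover have "last w' < label T (Horiz j)" if j: "j \<in> set C'" "\<forall>i\<in>set R'. \<not> has_one T i j" for j
  proof -
    obtain i where i: "i \<in> set R" "has_one T i j" using C'one j(1) by blast
    then have iq: "i \<in> set (filter Q R)" using j(2) by (auto simp: R')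
    then have ne: "filter Q R \<noteq> []" by (metis empty_iff empty_set)
    have hd: "hd (filter Q R) \<le> i" using sorted_hd_le[OF _ iq] R by (auto simp: sorted_wrt_filter)
    have "last w' = label T (Vert (hd (filter Q R)))" unfolding w' c_def by (rule last_map_rev[OF ne])
    also have "\<dots> \<le> label T (Vert i)"
      using label_order(1)[OF cov, of "hd (filter Q R)" i] hd i R by (cases "hd (filter Q R) = i") auto
    also have "\<dots> < label T (Horiz j)"
      using i label_order(3)[OF cov, of i j] in_diagram_bounds[of i j] by (simp add: has_one_def)
    finally show ?thesis .
  qed
  ultimately have "round_inv (C', R', w')" using r2 by (simp add: round_inv_def)
  moreover have "length C' + length R' < length C + length R"
  proof -
    have "length C' + length (filter P C) = length C" "length R' + length (filter Q R) = length R"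
      unfolding C' R' using sum_length_filter_compl[of P C] sum_length_filter_compl[of Q R] by simp_all
    moreover have "length (filter P C) > 0 \<or> length (filter Q R) > 0" using progress by blast
    ultimately show ?thesis by linarith
  qed
  ultimately show ?thesis by blast
qed

text \<open>
  Once all rows and columns are read, \<open>reading\<close> describes the whole filling.
\<close>

lemma Psi_spec:
  assumes new: "NEW_tableau T"
  shows "Psi T \<in> perms n" "bottoms (Psi T) = row_labels T"
    "in_diagram T i j \<Longrightarrow> has_one T i j \<longleftrightarrow> before (Psi T) (label T (Vert i)) (label T (Horiz j))"
proof -
  let ?b = "\<lambda>(C, R, w). C \<noteq> [] \<or> R \<noteq> ([] :: nat list)"
  let ?s = "([0..<num_cols T], [0..<num_rows T], []) :: nat list \<times> nat list \<times> nat list"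
  let ?S = "while ?b (Psi_round T) ?s"
  have "round_inv ?S \<and> \<not> ?b ?S"
  proof (rule while_rule[where P = round_inv and r = "measure (\<lambda>(C, R, w). length C + length R)"])
    have "reading [0..<num_cols T] [0..<num_rows T] []"
      unfolding reading_def num_rows_def by (auto simp: bottoms_match_Nil strict_sorted_iff dest: in_diagram_bounds)
    moreover have "\<forall>j<num_cols T. \<exists>i<num_rows T. has_one T i j"
      using cov by (simp add: covered_def every_col_has_one_def)
    ultimately show "round_inv ?s" unfolding round_inv_def by (simp add: Ball_def Bex_def)
  next
    fix s assume "round_inv s" "?b s"
    then show "round_inv (Psi_round T s)"
      using round_inv_step[OF new] by (cases s; cases "Psi_round T s") auto
  next
    fix s assume "round_inv s" "\<not> ?b s"
    then show "round_inv s \<and> \<not> ?b s" by blast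
  next
    show "wf (measure (\<lambda>(C, R, w). length C + length R))" by simp
  next
    fix s assume "round_inv s" "?b s"
    then show "(Psi_round T s, s) \<in> measure (\<lambda>(C, R, w). length C + length R)"
      using round_inv_step[OF new] by (cases s; cases "Psi_round T s") auto
  qed
  moreover have "?S = (fst ?S, fst (snd ?S), snd (snd ?S))" by simp
  moreover have "Psi T = snd (snd ?S)" unfolding Psi_def by (simp add: case_prod_unfold)
  ultimately have "?S = ([], [], Psi T)" and "round_inv ?S" by (auto simp: case_prod_unfold)
  then have r: "reading [] [] (Psi T)" by (simp add: round_inv_def)
  have d: "distinct (Psi T)" and g: "bottoms_match (row_labels T) (Psi T)" and sub: "set (Psi T) \<subseteq> {1..n}"
    and V: "\<And>i. i < length T \<Longrightarrow> label T (Vert i) \<in> set (Psi T)"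
    and H: "\<And>j. j < num_cols T \<Longrightarrow> label T (Horiz j) \<in> set (Psi T)"
    and one: "\<And>i j. in_diagram T i j \<Longrightarrow> has_one T i j \<longleftrightarrow> before (Psi T) (label T (Vert i)) (label T (Horiz j))"
    using r unfolding reading_def by auto
  have RL: "row_labels T \<subseteq> set (Psi T)" using V by (auto simp: row_labels_def)
  have "{1..n} \<subseteq> set (Psi T)"
  proof
    fix c assume c: "c \<in> {1..n}"
    show "c \<in> set (Psi T)"
    proof (cases "c \<in> row_labels T")
      case False
      then obtain j where "j < num_cols T" "c = label T (Horiz j)" using c Horiz_label_iff[of c] by blast
      then show ?thesis using H by simp
    qed (use RL in blast)
  qed
  then show "Psi T \<in> perms n" using sub d by (auto simp: perms_def)
  show "bottoms (Psi T) = row_labels T" using bottoms_match_bottoms[OF g d RL] .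
  show "in_diagram T i j \<Longrightarrow> has_one T i j \<longleftrightarrow> before (Psi T) (label T (Vert i)) (label T (Horiz j))"
    using one .
qed

lemma ones_iff:
  assumes "i < length T" "j < num_cols T"
  shows "(label T (Vert i), label T (Horiz j)) \<in> ones T \<longleftrightarrow> has_one T i j"
proof
  assume "(label T (Vert i), label T (Horiz j)) \<in> ones T"
  then obtain i' j' where ij: "label T (Vert i) = label T (Vert i')" "label T (Horiz j) = label T (Horiz j')"
    "has_one T i' j'" by (auto simp: ones_def)
  then have "i = i'" "j = j'" using assms label_cases(1,2) in_diagram_bounds by (auto simp: has_one_def)
  then show "has_one T i j" using ij by simp
qed (auto simp: ones_def)

end

text \<open>
  The filling encoded by a word.
\<close>

definition cells :: "nat \<Rightarrow> nat list \<Rightarrow> (nat \<times> nat) set" where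
  "cells n w = {(r, c). r \<in> bottoms w \<and> c \<in> {1..n} - bottoms w \<and> r < c \<and> before w r c}"

lemma ones_Psi:
  assumes "T \<in> covered n" "NEW_tableau T"
  shows "ones T = cells n (Psi T)"
proof -
  note sp = Psi_spec[OF assms]
  have "(r, c) \<in> ones T \<longleftrightarrow> (r, c) \<in> cells n (Psi T)" for r c
  proof
    assume "(r, c) \<in> ones T"
    then obtain i j where ij: "r = label T (Vert i)" "c = label T (Horiz j)" "has_one T i j" by (auto simp: ones_def)
    have d: "in_diagram T i j" using ij by (simp add: has_one_def)
    have b: "i < length T" "j < num_cols T" using in_diagram_bounds[OF assms(1) d] by auto
    have "r \<in> row_labels T" using b ij by (auto simp: row_labels_def)
    moreover have "c \<in> {1..n} - row_labels T" using b ij Horiz_label_iff[OF assms(1)] by blast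
    moreover have "r < c" using label_order(3)[OF assms(1) b] d ij by simp
    moreover have "before (Psi T) r c" using sp(3)[OF d] ij by simp
    ultimately show "(r, c) \<in> cells n (Psi T)" using sp(2) by (simp add: cells_def)
  next
    assume "(r, c) \<in> cells n (Psi T)"
    then have a: "r \<in> row_labels T" "c \<in> {1..n} - row_labels T" "r < c" "before (Psi T) r c"
      using sp(2) by (auto simp: cells_def)
    obtain i where i: "i < length T" "r = label T (Vert i)" using a(1) by (auto simp: row_labels_def)
    obtain j where j: "j < num_cols T" "c = label T (Horiz j)" using a(2) Horiz_label_iff[OF assms(1)] by blast
    have "in_diagram T i j" using label_order(3)[OF assms(1) i(1) j(1)] a(3) i j by simp
    then show "(r, c) \<in> ones T" using sp(3) a(4) i j ones_iff[OF assms(1) i(1) j(1)] by simp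
  qed
  then show ?thesis by auto
qed

lemma ones_inj: "T \<in> covered n \<Longrightarrow> T' \<in> covered n \<Longrightarrow> ones T = ones T' \<Longrightarrow> T = T'"
proof (induction n arbitrary: T T')
  case 0
  then show ?case by (simp add: covered_0)
next
  case (Suc n)
  obtain U S where U: "U \<in> covered n" "S \<subseteq> row_labels U" "T = extend U S"
    using covered_SucE[OF Suc.prems(1)] by blast
  obtain U' S' where U': "U' \<in> covered n" "S' \<subseteq> row_labels U'" "T' = extend U' S'"
    using covered_SucE[OF Suc.prems(2)] by blast
  have split: "S = {r. (r, Suc n) \<in> ones (extend U S)} \<and> ones U = {x \<in> ones (extend U S). snd x \<noteq> Suc n}"
    if "U \<in> covered n" "S \<subseteq> row_labels U" for U S
  proof -
    have "(r, Suc n) \<notin> ones U" for r using ones_range[OF that(1)] by auto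
    then show ?thesis unfolding ones_extend[OF that] by auto
  qed
  have "S = S'" "ones U = ones U'" using split[OF U(1,2)] split[OF U'(1,2)] U(3) U'(3) Suc.prems(3) by simp_all
  then show ?case using Suc.IH[OF U(1) U'(1)] U(3) U'(3) by simp
qed

text \<open>
  Every set of pairs in which no label is both a row and a column is the set of ones of a covered
  tableau: the second components are the columns, all other labels are rows.
\<close>

lemma ones_surj:
  "E \<subseteq> {(r, c). 1 \<le> r \<and> r < c \<and> c \<le> n} \<Longrightarrow> fst ` E \<inter> snd ` E = {} \<Longrightarrow>
    \<exists>T\<in>covered n. ones T = E \<and> row_labels T = {1..n} - snd ` E"
proof (induction n arbitrary: E)
  case 0
  then have "E = {}" by auto
  then show ?case by (simp add: covered_0 ones_def has_one_def in_diagram_def row_labels_def)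
next
  case (Suc n)
  define E' where "E' = {x \<in> E. snd x \<le> n}"
  define S where "S = {r. (r, Suc n) \<in> E}"
  have "E' \<subseteq> {(r, c). 1 \<le> r \<and> r < c \<and> c \<le> n}" using Suc.prems(1) by (auto simp: E'_def)
  moreover have "fst ` E' \<inter> snd ` E' = {}" using Suc.prems(2) by (force simp: E'_def)
  ultimately obtain T where T: "T \<in> covered n" "ones T = E'" "row_labels T = {1..n} - snd ` E'"
    using Suc.IH by blast
  have E: "E = E' \<union> S \<times> {Suc n}"
  proof -
    have "c \<le> n \<or> c = Suc n" if "(r, c) \<in> E" for r c using Suc.prems(1) that by auto
    then have "(r, c) \<in> E \<longleftrightarrow> (r, c) \<in> E' \<union> S \<times> {Suc n}" for r c by (auto simp: E'_def S_def)
    then show ?thesis by auto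
  qed
  have S: "S \<subseteq> row_labels T"
  proof
    fix r assume r: "r \<in> S"
    then have "(r, Suc n) \<in> E" by (simp add: S_def)
    then have "r \<in> fst ` E" "1 \<le> r" "r \<le> n" using Suc.prems(1) by force+
    then show "r \<in> row_labels T" using Suc.prems(2) T(3) by (auto simp: E'_def)
  qed
  have "snd ` E = snd ` E' \<union> (if S = {} then {} else {Suc n})" unfolding E by (auto simp: image_Un)
  moreover have "snd ` E' \<subseteq> {..n}" by (auto simp: E'_def)
  ultimately have "row_labels (extend T S) = {1..Suc n} - snd ` E"
    unfolding row_labels_extend[OF T(1) S] T(3) by auto
  moreover have "ones (extend T S) = E" using ones_extend[OF T(1) S] T(2) E by simp
  ultimately show ?case using extend_covered[OF T(1) S] by blast
qed

lemma NEW_tableaux_covered: "NEW_tableaux n = {T \<in> covered n. NEW_tableau T}"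
  by (auto simp: NEW_tableaux_def covered_def NEW_tableau_def)

text \<open>
  With a 1 exactly where the row precedes the column in \<open>w\<close>, the corners of a forbidden rectangle
  would put two rows before each other. Every column contains a 1 by \<open>smaller_bottom_before\<close>.
\<close>

lemma Psi_surj:
  assumes w: "w \<in> perms n"
  shows "\<exists>T\<in>NEW_tableaux n. Psi T = w"
proof -
  have d: "distinct w" and st: "set w = {1..n}" using w by (auto simp: perms_def)
  have bs: "bottoms w \<subseteq> {1..n}" using st by (force simp: bottoms_def)
  have "cells n w \<subseteq> {(r, c). 1 \<le> r \<and> r < c \<and> c \<le> n}" using bs by (auto simp: cells_def)
  moreover have "fst ` cells n w \<inter> snd ` cells n w = {}" by (auto simp: cells_def)
  ultimately obtain T where T: "T \<in> covered n" "ones T = cells n w" "row_labels T = {1..n} - snd ` cells n w"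
    using ones_surj[of "cells n w" n] by blast
  have "snd ` cells n w = {1..n} - bottoms w"
  proof (intro equalityI subsetI)
    fix c assume c: "c \<in> {1..n} - bottoms w"
    then have "c \<in> set w" using st by simp
    then obtain p where p: "p < length w" "w ! p = c" by (auto simp: in_set_conv_nth)
    obtain i where i: "i < p" "w ! i \<in> bottoms w" "w ! i < c" using smaller_bottom_before[OF d p(1)] p c by auto
    have "before w (w ! i) c" using before_nth[OF d, of i p] i p by simp
    then show "c \<in> snd ` cells n w" using i c by (intro image_eqI[of _ _ "(w ! i, c)"]) (auto simp: cells_def)
  qed (auto simp: cells_def)
  then have RL: "row_labels T = bottoms w" using T(3) bs by auto
  have one: "has_one T i j \<longleftrightarrow> before w (label T (Vert i)) (label T (Horiz j))" if "in_diagram T i j" for i j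
  proof -
    have b: "i < length T" "j < num_cols T" using in_diagram_bounds[OF T(1) that] by auto
    have "label T (Vert i) \<in> bottoms w" using b(1) unfolding RL[symmetric] by (auto simp: row_labels_def)
    moreover have "label T (Horiz j) \<in> {1..n} - bottoms w"
      using b(2) Horiz_label_iff[OF T(1)] unfolding RL[symmetric] by blast
    moreover have "label T (Vert i) < label T (Horiz j)" using label_order(3)[OF T(1) b] that by simp
    ultimately show ?thesis using ones_iff[OF T(1) b] T(2) by (simp add: cells_def)
  qed
  have zero: "before w (label T (Horiz j)) (label T (Vert i))" if "has_zero T i j" for i j
  proof -
    have dg: "in_diagram T i j" and "\<not> has_one T i j" using that by (auto simp: has_zero_def has_one_def)
    then have nb: "\<not> before w (label T (Vert i)) (label T (Horiz j))" using one by blast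
    have b: "i < length T" "j < num_cols T" using in_diagram_bounds[OF T(1) dg] by auto
    show ?thesis
      using nb before_total[of "label T (Vert i)" w "label T (Horiz j)"] label_range(1)[OF T(1) b(1)]
        label_range(2)[OF T(1) b(2)] label_cases(3)[OF T(1) b] st by simp
  qed
  have one': "before w (label T (Vert i)) (label T (Horiz j))" if "has_one T i j" for i j
    using that one[of i j] by (simp add: has_one_def)
  have nc: "\<not> (has_zero T i j \<and> has_zero T i' j' \<and> has_one T i j' \<and> has_one T i' j)" for i j i' j'
  proof
    assume a: "has_zero T i j \<and> has_zero T i' j' \<and> has_one T i j' \<and> has_one T i' j"
    have "before w (label T (Vert i)) (label T (Vert i'))"
      using before_trans[OF d] a one' zero by blast
    moreover have "before w (label T (Vert i')) (label T (Vert i))"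
      using before_trans[OF d] a one' zero by blast
    ultimately show False using before_asym[OF d] by blast
  qed
  have N: "NEW_tableau T" unfolding NEW_tableau_def
    using T(1) nc by (simp add: covered_def) blast
  have "Psi T = w"
  proof (rule perms_determined[OF Psi_spec(1)[OF T(1) N] w])
    show "bottoms (Psi T) = bottoms w" using Psi_spec(2)[OF T(1) N] RL by simp
    fix r c assume a: "r \<in> bottoms (Psi T)" "c \<in> {1..n} - bottoms (Psi T)" "r < c"
    have "before (Psi T) r c \<longleftrightarrow> (r, c) \<in> cells n (Psi T)" using a by (simp add: cells_def)
    also have "\<dots> \<longleftrightarrow> (r, c) \<in> cells n w" using ones_Psi[OF T(1) N] T(2) by simp
    also have "\<dots> \<longleftrightarrow> before w r c" using a Psi_spec(2)[OF T(1) N] RL by (simp add: cells_def)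
    finally show "before (Psi T) r c \<longleftrightarrow> before w r c" .
  qed
  then show ?thesis using T(1) N by (auto simp: NEW_tableaux_covered)
qed

lemma Psi_bij: "bij_betw Psi (NEW_tableaux n) (perms n)"
  unfolding bij_betw_def
proof (intro conjI equalityI subsetI)
  show "inj_on Psi (NEW_tableaux n)"
  proof (rule inj_onI)
    fix T T' assume "T \<in> NEW_tableaux n" "T' \<in> NEW_tableaux n" "Psi T = Psi T'"
    then show "T = T'" using ones_Psi[of T n] ones_Psi[of T' n] ones_inj[of T n T']
      by (simp add: NEW_tableaux_covered)
  qed
qed (use Psi_spec(1) Psi_surj in \<open>fastforce simp: NEW_tableaux_covered\<close>)+

section \<open>The composite map\<close>

lemma Gamma_bij: "bij_betw (Gamma n) (NEW_tableaux n) (Le_tableaux n)"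
proof -
  have "bij_betw (inv_into (Le_tableaux n) Phi) (perms n) (Le_tableaux n)"
    using Phi_bij by (rule bij_betw_inv_into)
  then show ?thesis unfolding Gamma_def
    using Psi_bij DE_bij down_shift_bij by (blast intro: bij_betw_trans)
qed

lemma Gamma_shape:
  assumes N: "N \<in> NEW_tableaux n"
  shows "shape (Gamma n N) = shape N"
proof -
  have Nc: "N \<in> covered n" "NEW_tableau N" using N by (auto simp: NEW_tableaux_covered)
  let ?w = "Psi N"
  let ?v = "down_shift (DE ?w)"
  have w: "?w \<in> perms n" using Psi_spec(1)[OF Nc] .
  have v: "?v \<in> perms n" using w DE_bij down_shift_bij by (blast dest: bij_betwE)
  have L: "Gamma n N \<in> covered n" "Phi (Gamma n N) = ?v"
    using Gamma_bij N Phi_bij v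
    by (auto simp: Gamma_def bij_betw_def Le_tableaux_covered f_inv_into_f)
  have "row_labels (Gamma n N) = {m \<in> {1..n}. m \<le> letter ?v m}"
    unfolding row_labels_Phi[OF L(1)] L(2) by (auto simp: letter_nth)
  also have "\<dots> = row_labels N" using weak_excedances_bottoms[OF w] Psi_spec(2)[OF Nc] by simp
  finally show ?thesis using shape_from_row_labels[OF L(1) Nc(1)] by blast
qed

theorem mainTheorem4:
  fixes n :: nat
  assumes "n \<ge> 1"
  shows "bij_betw (Gamma n) (NEW_tableaux n) (Le_tableaux n) \<and>
         (\<forall>N \<in> NEW_tableaux n. shape (Gamma n N) = shape N)"
  using Gamma_bij Gamma_shape by blast

end
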